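(* Let $n\ge1$, $1<p<\infty$ and $\frac1p+\frac1q=1$. A weight $w$ on $\partial\mathbb{B}_n$ is in $\mathrm{A}_p$ if and only if $$\|w\|_{\mathrm{A}_p^{\mathrm{Poi.}}}=\sup_{z\in\mathbb{B}_n}\left\{\widehat{w|k_z|^{p-2}}(z)\right\}\left\{\widehat{w^{-\frac1{p-1}}|k_z|^{q-2}}(z)\right\}^{p-1}<\infty.$$ In fact, there exists a constant $C$ independent of $w$ such that $$\frac1C\|w\|_{\mathrm{A}_p}\le\|w\|_{\mathrm{A}_p^{\mathrm{Poi.}}}\le C\|w\|_{\mathrm{A}_p}^{\max\{p+1,\,q+1\}}.$$
   Context: $\mathbb{B}_n$ is the open unit ball of $\mathbb{C}^n$, $\sigma$ is normalized surface measure on $\partial\mathbb{B}_n$, and $z\cdot u=\sum_jz_j\overline{u_j}$. A weight is a measurable function that is positive a.e. The normalized reproducing kernel of the Hardy space $H^2(\partial\mathbb{B}_n)$ at $z\in\mathbb{B}_n$ is $k_z(\zeta)=\frac{(1-|z|^2)^{n/2}}{(1-\zeta\cdot z)^n}$, and $\widehat h$ denotes the (invariant) Poisson extension $\widehat h(z)=\int_{\partial\mathbb{B}_n}h(\zeta)|k_z(\zeta)|^2\,d\sigma(\zeta)$. Non-isotropic balls in $\partial\mathbb{B}_n$ are the balls $B(u,r)=\{\zeta\in\partial\mathbb{B}_n:|1-\zeta\cdot u|^{1/2}<r\}$, $u\in\partial\mathbb{B}_n$, $r>0$. $\mathrm{A}_p$ is the class of weights $w$ on $\partial\mathbb{B}_n$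 with $$\|w\|_{\mathrm{A}_p}=\sup_B\left(\frac1{\sigma(B)}\int_Bw\,d\sigma\right)\left(\frac1{\sigma(B)}\int_Bw^{-\frac1{p-1}}\,d\sigma\right)^{p-1}<\infty,$$ the supremum being over all non-isotropic balls $B\subseteq\partial\mathbb{B}_n$. *)

theory Defs
  imports "HOL-Analysis.Analysis"
begin

text \<open>The complex space of dimension n is \<^typ>\<open>complex ^ 'n\<close> with n the cardinality of the index
  type \<open>'n\<close>; its library norm is the Euclidean one, so \<open>ball 0 1\<close> and \<open>sphere 0 1\<close> are the
  open unit ball and the unit sphere.\<close>

definition herm :: "complex ^ 'n \<Rightarrow> complex ^ 'n \<Rightarrow> complex" where
  "herm z u = (\<Sum>j\<in>UNIV. z $ j * cnj (u $ j))"

text \<open>Normalized surface measure, introduced through polar coordinates: a Borel subset of the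
  sphere is assigned the proportion of the volume of the unit ball lying over it (see
  \<open>emeasure_sphere_measure\<close> below).  The carrier is the sphere itself, and the measure is
  completed, so that measurable and almost everywhere have the Lebesgue meaning.\<close>

definition sphere_measure :: "(complex ^ 'n) measure" where
  "sphere_measure =
     completion (restrict_space
       (distr (uniform_measure lborel (ball 0 1)) borel (\<lambda>x. x /\<^sub>R norm x)) (sphere 0 1))"

lemma space_sphere_measure [simp]: "space (sphere_measure :: (complex ^ 'n) measure) = sphere 0 1"
  by (simp add: sphere_measure_def space_restrict_space)

lemma emeasure_sphere_measure:
  fixes A :: "(complex ^ 'n) set"
  assumes "A \<in> sets borel" "A \<subseteq> sphere 0 1"
  shows "emeasure sphere_measure A =
     emeasure lborel {x \<in> ball 0 1. x /\<^sub>R norm x \<in> A} / emeasure lborel (ball 0 1 :: (complex ^ 'n) set)"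
proof -
  let ?U = "uniform_measure lborel (ball 0 1 :: (complex ^ 'n) set)"
  let ?f = "\<lambda>x :: complex ^ 'n. x /\<^sub>R norm x"
  have f [measurable]: "?f \<in> borel_measurable borel" by measurable
  have fU: "?f \<in> measurable ?U borel" by simp
  have pre: "?f -` A \<in> sets borel"
    using measurable_sets[OF f assms(1)] by simp
  have A': "A \<in> sets (restrict_space (distr ?U borel ?f) (sphere 0 1))"
    using assms by (auto simp: sets_restrict_space)
  have "emeasure sphere_measure A = emeasure (restrict_space (distr ?U borel ?f) (sphere 0 1)) A"
    unfolding sphere_measure_def using A' by simp
  also have "\<dots> = emeasure (distr ?U borel ?f) A"
    using assms by (intro emeasure_restrict_space) auto
  also have "\<dots> = emeasure ?U (?f -` A)"
    using assms fU by (simp add: emeasure_distr)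
  also have "\<dots> = emeasure lborel (ball 0 1 \<inter> ?f -` A) / emeasure lborel (ball 0 1 :: (complex ^ 'n) set)"
    using pre by (intro emeasure_uniform_measure) auto
  also have "ball 0 1 \<inter> ?f -` A = {x \<in> ball 0 1. ?f x \<in> A}" by auto
  finally show ?thesis .
qed

lemma emeasure_sphere_measure_space:
  "emeasure (sphere_measure :: (complex ^ 'n) measure) (sphere 0 1) = 1"
proof -
  let ?B = "ball 0 1 :: (complex ^ 'n) set"
  have eq: "{x \<in> ?B. x /\<^sub>R norm x \<in> sphere 0 1} = ?B - {0}"
    by auto
  have "emeasure lborel (?B - {0}) = emeasure lborel ?B"
    by (intro emeasure_Diff_null_set) auto
  moreover have "emeasure lborel ?B \<noteq> 0" "emeasure lborel ?B \<noteq> \<infinity>"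
    using emeasure_lborel_ball_finite[of "0 :: complex ^ 'n" 1]
      negligible_iff_null_sets[of ?B] open_not_negligible[of ?B]
    by (auto simp: null_sets_def)
  ultimately show ?thesis
    by (simp only: emeasure_sphere_measure[OF borel_closed[OF closed_sphere] order.refl] eq)
       (simp add: ennreal_divide_self less_top)
qed

definition weight :: "(complex ^ 'n \<Rightarrow> real) \<Rightarrow> bool" where
  "weight w \<longleftrightarrow> w \<in> borel_measurable sphere_measure \<and> (AE \<zeta> in sphere_measure. 0 < w \<zeta>)"

definition nonisotropic_ball :: "complex ^ 'n \<Rightarrow> real \<Rightarrow> (complex ^ 'n) set" where
  "nonisotropic_ball u r = {\<zeta> \<in> sphere 0 1. sqrt (cmod (1 - herm \<zeta> u)) < r}"

text \<open>Real powers of extended nonnegative numbers; meant for positive exponents, for which the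
  value at infinity is infinity.\<close>

definition ennreal_powr :: "ennreal \<Rightarrow> real \<Rightarrow> ennreal" where
  "ennreal_powr x a = (if x = \<infinity> then \<infinity> else ennreal (enn2real x powr a))"

definition average :: "(complex ^ 'n) set \<Rightarrow> (complex ^ 'n \<Rightarrow> real) \<Rightarrow> ennreal" where
  "average B h = (\<integral>\<^sup>+ \<zeta> \<in> B. ennreal (h \<zeta>) \<partial>sphere_measure) / emeasure sphere_measure B"

definition Ap_norm :: "real \<Rightarrow> (complex ^ 'n \<Rightarrow> real) \<Rightarrow> ennreal" where
  "Ap_norm p w =
     (SUP B \<in> {nonisotropic_ball u r | u r. u \<in> sphere 0 1 \<and> 0 < r}.
        average B w * ennreal_powr (average B (\<lambda>\<zeta>. w \<zeta> powr (- (1 / (p - 1))))) (p - 1))"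

definition Ap_class :: "real \<Rightarrow> (complex ^ 'n \<Rightarrow> real) set" where
  "Ap_class p = {w. weight w \<and> Ap_norm p w < \<infinity>}"

definition normalized_kernel :: "complex ^ 'n \<Rightarrow> complex ^ 'n \<Rightarrow> complex" where
  "normalized_kernel z \<zeta> =
     complex_of_real ((1 - (norm z)\<^sup>2) powr (real CARD('n) / 2)) / (1 - herm \<zeta> z) ^ CARD('n)"

text \<open>The Poisson extension of a function that is nonnegative almost everywhere; the value may be
  infinite.\<close>

definition poisson_ext :: "(complex ^ 'n \<Rightarrow> real) \<Rightarrow> complex ^ 'n \<Rightarrow> ennreal" where
  "poisson_ext h z =
     (\<integral>\<^sup>+ \<zeta>. ennreal (h \<zeta> * (cmod (normalized_kernel z \<zeta>))\<^sup>2) \<partial>sphere_measure)"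

text \<open>The exponent \<open>q\<close> is a separate argument; it is meant to be the conjugate exponent of \<open>p\<close>.\<close>

definition Ap_Poi_norm :: "real \<Rightarrow> real \<Rightarrow> (complex ^ 'n \<Rightarrow> real) \<Rightarrow> ennreal" where
  "Ap_Poi_norm p q w =
     (SUP z \<in> ball 0 1.
        poisson_ext (\<lambda>\<zeta>. w \<zeta> * cmod (normalized_kernel z \<zeta>) powr (p - 2)) z *
        ennreal_powr
          (poisson_ext (\<lambda>\<zeta>. w \<zeta> powr (- (1 / (p - 1))) * cmod (normalized_kernel z \<zeta>) powr (q - 2)) z)
          (p - 1))"

end

theory Submission
  imports Defs
begin

text \<open>Unitary invariance and a comparison of cones with boxes show that a non-isotropic ball of radius
  \<open>r \<le> 2\<close> has measure comparable to \<open>r ^ (2 * n)\<close>.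

  Lower estimate: on \<open>B(u, r)\<close> with \<open>r \<le> 1\<close>, the kernel at \<open>z = (1 - r\<^sup>2) u\<close> is at least a constant
  times \<open>r powr (- n)\<close>, and the powers of \<open>r\<close> cancel in the product.

  Upper estimate: cover the sphere by the balls \<open>B\<^sub>k = B(u, 2 / M ^ k)\<close>, \<open>k \<le> N\<close>, down to the scale
  \<open>sqrt (1 - norm z)\<close>.  The kernel is bounded by a multiple of \<open>D ^ k\<close> on the \<open>k\<close>-th annulus, where
  \<open>D = M ^ (2 * n)\<close>, so the two Poisson integrals are bounded by the sums of \<open>(D powr p) ^ k * W k\<close> and
  \<open>(D powr q) ^ k * V k\<close>, with \<open>W k\<close> and \<open>V k\<close> the integrals of the weight and its dual over \<open>B\<^sub>k\<close>.
  In the product, diagonal terms are controlled by the \<open>A\<^sub>p\<close> condition, and off-diagonal ones decay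
  geometrically by reverse doubling, at rates \<open>1 - c / A\<close> for \<open>W\<close> and \<open>1 - c / A powr (q - 1)\<close> for \<open>V\<close>.
  This even gives the exponent \<open>max p q\<close>.\<close>

section \<open>The measure of non-isotropic balls\<close>

lemma nn_integral_translate:
  fixes g :: "'a::euclidean_space \<Rightarrow> ennreal"
  assumes "distr M borel ((+) c) = M" "sets M = sets borel" "g \<in> borel_measurable borel"
  shows "(\<integral>\<^sup>+ x. g (c + x) \<partial>M) = (\<integral>\<^sup>+ x. g x \<partial>M)"
proof -
  have "(\<integral>\<^sup>+ x. g x \<partial>M) = (\<integral>\<^sup>+ x. g x \<partial>distr M borel ((+) c))"
    by (simp only: assms(1))
  also have "\<dots> = (\<integral>\<^sup>+ x. g (c + x) \<partial>M)"
    using assms(2,3) by (intro nn_integral_distr) (simp_all cong: measurable_cong_sets)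
  finally show ?thesis by simp
qed

text \<open>Translation-invariant measures are proportional, and the unit ball fixes the constant.\<close>
lemma distr_lborel_linear_isometry:
  fixes f :: "'a::euclidean_space \<Rightarrow> 'a"
  assumes f: "linear f" and nf: "\<And>x. norm (f x) = norm x"
  shows "distr lborel borel f = lborel"
proof -
  have [measurable]: "f \<in> borel_measurable borel"
    by (intro borel_measurable_continuous_onI linear_continuous_on linear_conv_bounded_linear[THEN iffD1] f)
  define \<mu> where "\<mu> = distr lborel borel f"
  have sets_mu[measurable_cong]: "sets \<mu> = sets borel" and space_mu: "space \<mu> = UNIV"
    by (simp_all add: \<mu>_def)
  have inj: "inj f"
    using linear_injective_0[OF f] nf by (metis norm_eq_zero)
  have surj: "surj f"
    using linear_injective_imp_surjective[OF f inj] by simp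
  \<comment> \<open>Since \<open>f\<close> is onto, every \<open>c\<close> is some
    \<open>f d\<close>. By linearity, translating the image measure by \<open>f d\<close> amounts to
    translating Lebesgue measure by \<open>d\<close> before applying \<open>f\<close>.\<close>
  have trans: "distr \<mu> borel ((+) c) = \<mu>" for c
  proof -
    obtain d where d: "c = f d" using surj by (metis surjD)
    have "distr \<mu> borel ((+) c) = distr lborel borel (\<lambda>x. f d + f x)"
      unfolding \<mu>_def d by (subst distr_distr) (auto simp: o_def)
    also have "\<dots> = distr lborel borel (f \<circ> (+) d)"
      by (simp add: o_def linear_add[OF f])
    also have "\<dots> = distr (distr lborel borel ((+) d)) borel f"
      by (subst distr_distr) auto
    finally show ?thesis by (simp add: lborel_distr_plus \<mu>_def)
  qed
  have ball_mu: "emeasure \<mu> (ball 0 r) = emeasure lborel (ball (0::'a) r)" for r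
  proof -
    have "f -` ball 0 r = ball 0 r" by (auto simp: nf)
    then show ?thesis by (simp add: \<mu>_def emeasure_distr)
  qed
  have "sigma_finite_measure \<mu>"
  proof
    have "\<exists>n::nat. norm x < real n" for x :: 'a by (rule reals_Archimedean2)
    then show "\<exists>A. countable A \<and> A \<subseteq> sets \<mu> \<and> \<Union> A = space \<mu> \<and> (\<forall>a\<in>A. emeasure \<mu> a \<noteq> \<infinity>)"
      using emeasure_lborel_ball_finite[of "0::'a"]
      by (intro exI[of _ "range (\<lambda>n::nat. ball 0 (real n))"])
         (auto simp: sets_mu space_mu ball_mu less_top)
  qed
  then interpret mu: sigma_finite_measure \<mu> .
  interpret pair_sigma_finite lborel \<mu> ..
  define B where "B = ball (0::'a) 1"
  have Bm[measurable]: "B \<in> sets borel" by (simp add: B_def)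
  have B0: "emeasure lborel B \<noteq> 0" "emeasure lborel B \<noteq> \<infinity>"
    using emeasure_lborel_ball_finite[of "0 :: 'a" 1]
      negligible_iff_null_sets[of B] open_not_negligible[of B]
    by (auto simp: null_sets_def B_def)
  have "emeasure \<mu> A = emeasure lborel A" if [measurable]: "A \<in> sets borel" for A
  proof -
    \<comment> \<open>The double integral of \<open>?F\<close> is evaluated in two ways. Integrating
      over \<open>y\<close> first gives \<open>emeasure lborel B * emeasure \<mu> A\<close>;
      shifting \<open>x\<close> by \<open>y\<close> and using the symmetry of \<open>B\<close> gives
      \<open>emeasure \<mu> B * emeasure lborel A\<close>. Both measures give \<open>B\<close> the
      same positive finite value, which cancels.\<close>
    let ?F = "\<lambda>x y. indicator B x * indicator A (y + x) :: ennreal"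
    have "(\<integral>\<^sup>+x. \<integral>\<^sup>+y. ?F x y \<partial>\<mu> \<partial>lborel) = (\<integral>\<^sup>+x. indicator B x * emeasure \<mu> A \<partial>lborel)"
    proof (rule nn_integral_cong)
      fix x
      have "(\<integral>\<^sup>+y. ?F x y \<partial>\<mu>) = indicator B x * (\<integral>\<^sup>+y. indicator A (x + y) \<partial>\<mu>)"
        by (subst nn_integral_cmult[symmetric]) (auto simp: add.commute)
      also have "(\<integral>\<^sup>+y. indicator A (x + y) \<partial>\<mu>) = emeasure \<mu> A"
        by (subst nn_integral_translate[OF trans sets_mu]) (auto simp: sets_mu)
      finally show "(\<integral>\<^sup>+y. ?F x y \<partial>\<mu>) = indicator B x * emeasure \<mu> A" .
    qed
    also have "\<dots> = emeasure lborel B * emeasure \<mu> A"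
      by (subst nn_integral_multc) auto
    finally have 1: "(\<integral>\<^sup>+x. \<integral>\<^sup>+y. ?F x y \<partial>\<mu> \<partial>lborel) = emeasure lborel B * emeasure \<mu> A" .
    have "(\<integral>\<^sup>+x. \<integral>\<^sup>+y. ?F x y \<partial>\<mu> \<partial>lborel) = (\<integral>\<^sup>+y. \<integral>\<^sup>+x. ?F x y \<partial>lborel \<partial>\<mu>)"
      by (rule Fubini'[symmetric]) measurable
    also have "\<dots> = (\<integral>\<^sup>+y. \<integral>\<^sup>+x. indicator B (x - y) * indicator A x \<partial>lborel \<partial>\<mu>)"
    proof (rule nn_integral_cong)
      fix y
      show "(\<integral>\<^sup>+x. ?F x y \<partial>lborel) = (\<integral>\<^sup>+x. indicator B (x - y) * indicator A x \<partial>lborel)"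
        using nn_integral_translate[OF lborel_distr_plus[of y], of "\<lambda>x. indicator B (x - y) * indicator A x"]
        by simp
    qed
    also have "\<dots> = (\<integral>\<^sup>+x. \<integral>\<^sup>+y. indicator B (x - y) * indicator A x \<partial>\<mu> \<partial>lborel)"
      by (rule Fubini') measurable
    also have "\<dots> = (\<integral>\<^sup>+x. emeasure \<mu> B * indicator A x \<partial>lborel)"
    proof (rule nn_integral_cong)
      fix x
      have "(\<integral>\<^sup>+y. indicator B (x - y) * indicator A x \<partial>\<mu>) = (\<integral>\<^sup>+y. indicator B (- x + y) \<partial>\<mu>) * indicator A x"
        by (subst nn_integral_multc[symmetric])
           (auto simp: B_def indicator_def norm_minus_commute)
      also have "(\<integral>\<^sup>+y. indicator B (- x + y) \<partial>\<mu>) = emeasure \<mu> B"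
        by (subst nn_integral_translate[OF trans sets_mu]) (auto simp: sets_mu)
      finally show "(\<integral>\<^sup>+y. indicator B (x - y) * indicator A x \<partial>\<mu>) = emeasure \<mu> B * indicator A x" .
    qed
    also have "\<dots> = emeasure lborel B * emeasure lborel A"
      by (subst nn_integral_cmult) (auto simp: ball_mu B_def)
    finally show ?thesis
      using 1 B0 by (simp add: ennreal_mult_cancel_left)
  qed
  then show ?thesis
    by (intro measure_eqI) (auto simp: \<mu>_def)
qed

section \<open>The Hermitian form and its isometries\<close>

lemma herm_add_left: "herm (x + y) u = herm x u + herm y u"
  by (simp add: herm_def algebra_simps sum.distrib)

lemma herm_diff_left: "herm (x - y) u = herm x u - herm y u"
  by (simp add: herm_def algebra_simps sum_subtractf)

lemma herm_smult_left: "herm (c *s x) u = c * herm x u"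
  by (simp add: herm_def sum_distrib_left algebra_simps)

lemma cnj_herm: "cnj (herm x u) = herm u x"
  by (simp add: herm_def mult.commute)

lemma herm_diff_right: "herm x (y - z) = herm x y - herm x z"
  by (metis cnj_herm complex_cnj_diff herm_diff_left)

lemma herm_smult_right: "herm x (c *s y) = cnj c * herm x y"
  by (metis cnj_herm complex_cnj_mult herm_smult_left)

lemma scaleR_eq_smult: "r *\<^sub>R x = complex_of_real r *s x"
  for x :: "complex ^ 'n"
  by (simp add: vec_eq_iff) (simp add: scaleR_conv_of_real)

lemma herm_scaleR_left: "herm (r *\<^sub>R x) u = r * herm x u"
  by (simp add: scaleR_eq_smult herm_smult_left)

lemma herm_scaleR_right: "herm x (r *\<^sub>R u) = r * herm x u"
  by (simp add: scaleR_eq_smult herm_smult_right)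

lemma norm_power2_eq_sum: "(norm x)\<^sup>2 = (\<Sum>i\<in>UNIV. (cmod (x $ i))\<^sup>2)"
  for x :: "complex ^ 'n"
  by (simp add: norm_vec_def L2_set_def sum_nonneg)

lemma herm_self: "herm x x = complex_of_real ((norm x)\<^sup>2)"
  by (simp add: herm_def norm_power2_eq_sum complex_norm_square[symmetric])

lemma norm_smult: "norm (c *s x) = cmod c * norm x"
  for x :: "complex ^ 'n"
proof -
  have "(norm (c *s x))\<^sup>2 = (cmod c * norm x)\<^sup>2"
    by (simp add: norm_power2_eq_sum power_mult_distrib norm_mult sum_distrib_left)
  then show ?thesis by (simp add: power2_eq_iff_nonneg)
qed

lemma Re_herm: "Re (herm x u) = x \<bullet> u"
  by (simp add: herm_def inner_vec_def inner_complex_def)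

text \<open>Multiplying \<open>x\<close> by a unimodular number makes the form real and nonnegative,
  so that it equals the real inner product, for which Cauchy-Schwarz is available.\<close>

lemma norm_herm_le: "cmod (herm x u) \<le> norm x * norm u"
proof (cases "herm x u = 0")
  case False
  define c where "c = cnj (herm x u) / cmod (herm x u)"
  have c: "cmod c = 1" using False by (simp add: c_def norm_divide)
  have "herm (c *s x) u = cmod (herm x u)"
    using False by (simp add: c_def herm_smult_left mult.commute complex_norm_square[symmetric] power2_eq_square
      del: of_real_mult) simp
  then have "cmod (herm x u) = (c *s x) \<bullet> u"
    by (metis Re_complex_of_real Re_herm)
  also have "\<dots> \<le> norm (c *s x) * norm u" by (rule norm_cauchy_schwarz)
  finally show ?thesis by (simp add: norm_smult c)
qed simp

text \<open>A Householder reflection carries \<open>u\<close> to a unimodular multiple of the \<open>k\<close>-th unit vector.\<close>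
lemma isometry_to_coordinate:
  fixes u :: "complex ^ 'n" and k :: 'n
  assumes u: "norm u = 1"
  obtains T :: "complex ^ 'n \<Rightarrow> complex ^ 'n" where "linear T" "\<And>x. norm (T x) = norm x"
    "\<And>x. T x $ k = herm x u"
proof -
  \<comment> \<open>\<open>\<theta>\<close> is the phase of \<open>u $ k\<close>, with default 1 at
    zero. It makes \<open>herm u a\<close> real, without which no reflection along
    \<open>a - u\<close> could exchange \<open>a\<close> and \<open>u\<close>.\<close>
  define \<theta> where "\<theta> = (if u $ k = 0 then 1 else u $ k / cmod (u $ k))"
  have \<theta>: "cmod \<theta> = 1" by (auto simp: \<theta>_def norm_divide)
  define a :: "complex ^ 'n" where "a = axis k \<theta>"
  have herm_a: "herm x a = x $ k * cnj \<theta>" for x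
    by (simp add: herm_def a_def axis_def if_distrib[of cnj] if_distrib[of "\<lambda>z. _ * z"] sum.delta' cong: if_cong)
  have aa: "herm a a = 1"
    using \<theta> by (simp add: herm_a complex_norm_square[symmetric]) (simp add: a_def complex_norm_square[symmetric])
  then have na: "norm a = 1"
    by (simp add: herm_self power2_eq_1_iff flip: of_real_power) (smt (verit) norm_ge_zero)
  have ua: "herm u a = cmod (u $ k)"
    by (auto simp: herm_a \<theta>_def complex_norm_square[symmetric] power2_eq_square)
  have au: "herm a u = cmod (u $ k)"
    by (metis ua cnj_herm complex_cnj_complex_of_real)
  define v where "v = a - u"
  \<comment> \<open>If \<open>v = 0\<close>, division by zero gives \<open>t = 0\<close>; the map
    \<open>U\<close> below is then the identity and \<open>a = u\<close>.\<close>
  define t where "t = 2 / (norm v)\<^sup>2"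
  have nv: "(norm v)\<^sup>2 = 2 * (1 - cmod (u $ k))"
  proof -
    have "complex_of_real ((norm v)\<^sup>2) = 2 * (1 - cmod (u $ k))"
      unfolding herm_self[symmetric] v_def
      by (simp add: herm_diff_left herm_diff_right ua au aa) (simp add: herm_self u)
    then show ?thesis using of_real_eq_iff by fastforce
  qed
  define U where "U x = x - (t * herm x v) *s v" for x
  have herm_U: "herm (U x) y = herm x (U y)" for x y
    by (simp add: U_def herm_diff_left herm_diff_right herm_smult_left herm_smult_right cnj_herm)
  have UU: "U (U x) = x" for x
  proof (cases "v = 0")
    case True then show ?thesis by (simp add: U_def)
  next
    case False
    then have "t * herm v v = 2" by (simp add: t_def herm_self)
    then have "t * herm (U x) v = - (t * herm x v)"
      by (simp add: U_def herm_diff_left herm_smult_left algebra_simps)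
    then have "U (U x) = U x + (t * herm x v) *s v"
      unfolding U_def[of "U x"] by simp
    then show ?thesis by (simp add: U_def)
  qed
  have Ua: "U a = u"
  proof (cases "v = 0")
    case True then show ?thesis by (simp add: U_def v_def)
  next
    case False
    have "herm a v = (norm v)\<^sup>2 / 2"
      unfolding nv by (simp add: v_def herm_diff_right aa au)
    then have "t * herm a v = 1" using False by (simp add: t_def field_simps)
    then show ?thesis by (simp add: U_def v_def)
  qed
  have nU: "norm (U x) = norm x" for x
  proof -
    have "complex_of_real ((norm (U x))\<^sup>2) = complex_of_real ((norm x)\<^sup>2)"
      by (metis herm_self herm_U UU)
    then show ?thesis by (metis of_real_eq_iff norm_ge_zero power2_eq_iff_nonneg)
  qed
  \<comment> \<open>\<open>U\<close> is self-adjoint and sends \<open>a\<close> to \<open>u\<close>,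
    so \<open>herm (U x) a = herm x u\<close>; the factor \<open>cnj \<theta>\<close> turns the left
    side into a plain coordinate.\<close>
  define T where "T x = cnj \<theta> *s U x" for x
  show ?thesis
  proof
    show "linear T"
      by (rule linearI)
         (simp_all add: T_def U_def herm_add_left scaleR_eq_smult herm_smult_left vec_eq_iff algebra_simps)
    show "norm (T x) = norm x" for x
      by (simp add: T_def norm_smult \<theta> nU)
    show "T x $ k = herm x u" for x
      using herm_U[of x a] by (simp add: T_def herm_a Ua mult.commute)
  qed
qed

section \<open>Comparison of cones over balls with coordinate boxes\<close>

lemma ball_Basis_complex_vec:
  "(\<forall>e\<in>(Basis :: (complex ^ 'n) set). P e) \<longleftrightarrow> (\<forall>j. P (axis j 1) \<and> P (axis j \<i>))"
  by (auto simp: Basis_vec_def Basis_complex_def)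

text \<open>The separate half-widths reflect the geometry of a non-isotropic ball: extent of order
  \<open>r\<^sup>2\<close> in the imaginary direction of coordinate \<open>k\<close>, of order
  \<open>r\<close> in the other complex coordinates. The real direction of coordinate
  \<open>k\<close> is the radial one in the cone.\<close>

definition coord_box :: "'n \<Rightarrow> real \<Rightarrow> real \<Rightarrow> real \<Rightarrow> real \<Rightarrow> (complex ^ 'n) set" where
  "coord_box k m a b c = {x. \<bar>Re (x $ k) - m\<bar> \<le> a \<and> \<bar>Im (x $ k)\<bar> \<le> b \<and>
     (\<forall>j. j \<noteq> k \<longrightarrow> \<bar>Re (x $ j)\<bar> \<le> c \<and> \<bar>Im (x $ j)\<bar> \<le> c)}"

text \<open>The set is a \<open>cbox\<close> with one side \<open>2 * a\<close>, one side
  \<open>2 * b\<close>, and the remaining \<open>2 * CARD('n) - 2\<close> sides equal to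
  \<open>2 * c\<close>.\<close>

lemma coord_box:
  fixes k :: "'n::finite"
  assumes "0 \<le> a" "0 \<le> b" "0 \<le> c"
  shows "coord_box k m a b c \<in> sets borel"
    and "emeasure lborel (coord_box k m a b c) = ennreal (4 * a * b * (2 * c) ^ (2 * CARD('n) - 2))"
proof -
  define s :: "complex ^ 'n \<Rightarrow> real"
    where "s e = (if e = axis k 1 then a else if e = axis k \<i> then b else c)" for e
  define h where "h = (\<Sum>e\<in>Basis. s e *\<^sub>R e)"
  define m' :: "complex ^ 'n" where "m' = axis k (complex_of_real m)"
  have h: "h \<bullet> e = s e" if "e \<in> Basis" for e
    using that by (simp add: h_def)
  have s0: "0 \<le> s e" for e using assms by (simp add: s_def)
  have s: "s (axis j 1) = (if j = k then a else c)" "s (axis j \<i>) = (if j = k then b else c)" for j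
    by (auto simp: s_def axis_eq_axis complex_eq_iff)
  have m': "m' $ j = (if j = k then m else 0)" for j
    by (simp add: m'_def axis_def)
  have eq: "coord_box k m a b c = cbox (m' - h) (m' + h)"
  proof (rule set_eqI)
    fix x
    have "x \<in> cbox (m' - h) (m' + h) \<longleftrightarrow> (\<forall>e\<in>Basis. \<bar>x \<bullet> e - m' \<bullet> e\<bar> \<le> s e)"
      unfolding mem_box by (intro ball_cong refl) (auto simp: inner_diff_left inner_add_left h)
    also have "\<dots> \<longleftrightarrow> (\<forall>j. \<bar>Re (x $ j) - (if j = k then m else 0)\<bar> \<le> (if j = k then a else c) \<and>
        \<bar>Im (x $ j)\<bar> \<le> (if j = k then b else c))"
      unfolding ball_Basis_complex_vec s inner_axis by (intro all_cong1) (simp add: m')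
    also have "\<dots> \<longleftrightarrow> x \<in> coord_box k m a b c"
      unfolding coord_box_def mem_Collect_eq by (auto split: if_split_asm)
    finally show "x \<in> coord_box k m a b c \<longleftrightarrow> x \<in> cbox (m' - h) (m' + h)" by simp
  qed
  show "coord_box k m a b c \<in> sets borel" unfolding eq by simp
  have "emeasure lborel (cbox (m' - h) (m' + h)) = ennreal (\<Prod>e\<in>Basis. 2 * s e)"
  proof (subst emeasure_lborel_cbox)
    have "(m' + h - (m' - h)) \<bullet> e = 2 * s e" if "e \<in> Basis" for e
      using h[OF that] by (simp only: inner_diff_left inner_add_left)
    then show "ennreal (prod ((\<bullet>) (m' + h - (m' - h))) Basis) = ennreal (\<Prod>e\<in>Basis. 2 * s e)"
      by (intro arg_cong[where f=ennreal] prod.cong refl) blast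
  qed (simp add: inner_diff_left inner_add_left h s0)
  also have "(\<Prod>e\<in>Basis. 2 * s e) = 2 * a * (2 * b * (2 * c) ^ (2 * CARD('n) - 2))"
  proof -
    have k: "axis k 1 \<in> (Basis :: (complex ^ 'n) set)" "axis k \<i> \<in> (Basis :: (complex ^ 'n) set) - {axis k 1}"
      by (auto simp: axis_eq_axis Basis_complex_def complex_eq_iff)
    have "(\<Prod>e\<in>Basis. 2 * s e) = 2 * a * (2 * b * (\<Prod>e\<in>Basis - {axis k 1} - {axis k \<i>}. 2 * s e))"
      using k by (subst prod.remove[OF _ k(1)], simp, subst prod.remove[OF _ k(2)])
        (auto simp: s_def axis_eq_axis)
    also have "(\<Prod>e\<in>Basis - {axis k 1} - {axis k \<i>}. 2 * s e) = (\<Prod>e\<in>(Basis :: (complex ^ 'n) set) - {axis k 1} - {axis k \<i>}. 2 * c)"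
      by (intro prod.cong) (auto simp: s_def)
    also have "\<dots> = (2 * c) ^ (2 * CARD('n) - 2)"
      using k by (simp add: card_Diff_subset mult.commute numeral_2_eq_2)
    finally show ?thesis .
  qed
  finally show "emeasure lborel (coord_box k m a b c) = ennreal (4 * a * b * (2 * c) ^ (2 * CARD('n) - 2))"
    unfolding eq by (simp add: mult_ac)
qed

text \<open>The part of the punctured unit ball lying radially over the non-isotropic ball around
  the \<open>k\<close>-th unit vector, since \<open>herm x (axis k 1)\<close> is
  \<open>x $ k\<close>.\<close>

definition coord_cone :: "'n \<Rightarrow> real \<Rightarrow> (complex ^ 'n) set" where
  "coord_cone k r = {x. norm x < 1 \<and> x \<noteq> 0 \<and> cmod (1 - x $ k / norm x) < r\<^sup>2}"

lemma continuous_on_herm [continuous_intros]: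
  assumes "continuous_on S f" "continuous_on S g"
  shows "continuous_on S (\<lambda>x. herm (f x) (g x))"
  unfolding herm_def by (intro continuous_intros assms continuous_on_component)

lemma coord_cone_borel [measurable]:
  fixes k :: "'n::finite"
  shows "coord_cone k r \<in> sets borel"
proof -
  have [measurable]: "(\<lambda>x :: complex ^ 'n. x $ k) \<in> borel_measurable borel"
    by (intro borel_measurable_continuous_onI continuous_on_component continuous_on_id)
  have "coord_cone k r = {x \<in> space borel. norm x < 1 \<and> x \<noteq> 0 \<and> cmod (1 - x $ k / norm x) < r\<^sup>2}"
    by (simp add: coord_cone_def)
  also have "\<dots> \<in> sets borel" by measurable
  finally show ?thesis .
qed

lemma nonisotropic_ball_iff:
  assumes "0 < r"
  shows "\<zeta> \<in> nonisotropic_ball u r \<longleftrightarrow> norm \<zeta> = 1 \<and> cmod (1 - herm \<zeta> u) < r\<^sup>2"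
  using assms real_sqrt_less_iff[of "cmod (1 - herm \<zeta> u)" "r\<^sup>2"]
  by (simp add: nonisotropic_ball_def)

lemma nonisotropic_ball_borel: "nonisotropic_ball u r \<in> sets borel"
proof -
  have "nonisotropic_ball u r = sphere 0 1 \<inter> {\<zeta>. sqrt (cmod (1 - herm \<zeta> u)) < r}"
    by (auto simp: nonisotropic_ball_def)
  moreover have "open {\<zeta>. sqrt (cmod (1 - herm \<zeta> u)) < r}"
    by (intro open_Collect_less continuous_intros)
  ultimately show ?thesis
    by (metis borel_open borel_closed closed_sphere sets.Int)
qed

text \<open>A volume-preserving isometry carries the cone over the ball around \<open>u\<close> to
  the coordinate cone. In particular the measure does not depend on \<open>u\<close>.\<close>

lemma emeasure_nonisotropic_ball:
  fixes u :: "complex ^ 'n" and k :: 'n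
  assumes u: "norm u = 1" and r: "0 < r"
  shows "emeasure sphere_measure (nonisotropic_ball u r) =
    emeasure lborel (coord_cone k r) / emeasure lborel (ball 0 1 :: (complex ^ 'n) set)"
proof -
  obtain T :: "complex ^ 'n \<Rightarrow> complex ^ 'n" where T: "linear T" "\<And>x. norm (T x) = norm x"
    "\<And>x. T x $ k = herm x u"
    using isometry_to_coordinate[OF u] by blast
  have T0: "T x = 0 \<longleftrightarrow> x = 0" for x by (metis T(2) norm_eq_zero)
  have "{x \<in> ball 0 1. x /\<^sub>R norm x \<in> nonisotropic_ball u r} = T -` coord_cone k r"
    by (auto simp: nonisotropic_ball_iff[OF r] coord_cone_def T T0 herm_scaleR_left divide_inverse mult.commute)
  then have "emeasure sphere_measure (nonisotropic_ball u r) =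
      emeasure lborel (T -` coord_cone k r) / emeasure lborel (ball 0 1 :: (complex ^ 'n) set)"
    by (subst emeasure_sphere_measure) (auto simp: nonisotropic_ball_borel, auto simp: nonisotropic_ball_def)
  also have "emeasure lborel (T -` coord_cone k r) = emeasure (distr lborel borel T) (coord_cone k r)"
    using T(1) by (subst emeasure_distr)
      (auto intro!: borel_measurable_continuous_onI linear_continuous_on simp: linear_conv_bounded_linear)
  also have "\<dots> = emeasure lborel (coord_cone k r)"
    by (simp only: distr_lborel_linear_isometry[OF T(1,2)])
  finally show ?thesis .
qed

lemma norm_mult_one_minus_quotient:
  fixes x :: "complex ^ 'n" and z :: complex
  assumes "x \<noteq> 0"
  shows "norm x * cmod (1 - z / norm x) = cmod (norm x - z)"
proof -
  have "norm x * (1 - z / norm x) = norm x - z"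
    using assms by (simp add: right_diff_distrib)
  then show ?thesis
    by (metis abs_norm_cancel norm_mult norm_of_real)
qed

text \<open>On the cone \<open>norm x - x $ k\<close> has modulus at most \<open>r\<^sup>2\<close>,
  which bounds the imaginary part. For \<open>j \<noteq> k\<close>, the square of
  \<open>cmod (x $ j)\<close> is at most
  \<open>(norm x - cmod (x $ k)) * (norm x + cmod (x $ k))\<close>, hence at most
  \<open>2 * r\<^sup>2\<close>.\<close>

lemma coord_cone_subset_coord_box:
  assumes r: "0 < r"
  shows "coord_cone k r \<subseteq> coord_box k 0 1 (r\<^sup>2) (2 * r)"
proof
  fix x assume "x \<in> coord_cone k r"
  then have x: "norm x < 1" "x \<noteq> 0" "cmod (1 - x $ k / norm x) < r\<^sup>2" by (auto simp: coord_cone_def)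
  have "cmod (norm x - x $ k) = norm x * cmod (1 - x $ k / norm x)"
    using norm_mult_one_minus_quotient[OF x(2)] by simp
  also have "\<dots> \<le> 1 * r\<^sup>2" using x by (intro mult_mono) auto
  finally have d: "cmod (norm x - x $ k) \<le> r\<^sup>2" by simp
  have k1: "cmod (x $ k) \<le> norm x" by (rule Finite_Cartesian_Product.norm_nth_le)
  have re: "\<bar>Re (x $ k)\<bar> \<le> 1" using abs_Re_le_cmod[of "x $ k"] k1 x(1) by linarith
  have im: "\<bar>Im (x $ k)\<bar> \<le> r\<^sup>2" using abs_Im_le_cmod[of "norm x - x $ k"] d by simp
  have j: "cmod (x $ j) \<le> 2 * r" if "j \<noteq> k" for j
  proof -
    have "(cmod (x $ k))\<^sup>2 + (cmod (x $ j))\<^sup>2 = (\<Sum>i\<in>{k,j}. (cmod (x $ i))\<^sup>2)" using that by simp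
    also have "\<dots> \<le> (norm x)\<^sup>2" unfolding norm_power2_eq_sum by (intro sum_mono2) auto
    finally have "(cmod (x $ j))\<^sup>2 \<le> (norm x - cmod (x $ k)) * (norm x + cmod (x $ k))"
      by (simp add: algebra_simps power2_eq_square)
    also have "\<dots> \<le> r\<^sup>2 * 2"
    proof (intro mult_mono)
      show "norm x - cmod (x $ k) \<le> r\<^sup>2"
        using norm_triangle_ineq2[of "complex_of_real (norm x)" "x $ k"] d unfolding norm_of_real by linarith
    qed (use k1 x in auto)
    also have "\<dots> \<le> (2 * r)\<^sup>2" by (simp add: power2_eq_square)
    finally show ?thesis by (rule power2_le_imp_le) (use r in simp)
  qed
  have "\<bar>Re (x $ j)\<bar> \<le> 2 * r \<and> \<bar>Im (x $ j)\<bar> \<le> 2 * r" if "j \<noteq> k" for j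
    using j[OF that] abs_Re_le_cmod[of "x $ j"] abs_Im_le_cmod[of "x $ j"] by linarith
  with re im show "x \<in> coord_box k 0 1 (r\<^sup>2) (2 * r)"
    unfolding coord_box_def by simp
qed

text \<open>The box is centred at 3/8 times a unit vector, away from both 0 and the sphere. Since
  \<open>CARD('n) * c\<close> is at most 1/16, the other coordinates barely change the norm, and
  \<open>norm x - x $ k\<close> has modulus at most \<open>3 * (c * r\<^sup>2)\<close>. Dividing by
  \<open>norm x \<ge> 1/4\<close> gives \<open>12 * (c * r\<^sup>2)\<close>, below
  \<open>r\<^sup>2\<close> because \<open>c \<le> 1/32\<close>. The bound \<open>r \<le> 2\<close>
  keeps \<open>norm x\<close> below 1.\<close>

lemma coord_box_subset_coord_cone:
  fixes k :: "'n::finite"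
  assumes r: "0 < r" "r \<le> 2" and c: "c = 1 / (16 * (real CARD('n) + 1))"
  shows "coord_box k (3/8) (1/8) (c * r\<^sup>2) (c * r) \<subseteq> coord_cone k r"
proof
  fix x assume "x \<in> coord_box k (3/8) (1/8) (c * r\<^sup>2) (c * r)"
  then have re: "1/4 \<le> Re (x $ k)" "Re (x $ k) \<le> 1/2" and im: "\<bar>Im (x $ k)\<bar> \<le> c * r\<^sup>2"
    and j: "\<And>j. j \<noteq> k \<Longrightarrow> \<bar>Re (x $ j)\<bar> \<le> c * r \<and> \<bar>Im (x $ j)\<bar> \<le> c * r"
    unfolding coord_box_def mem_Collect_eq abs_le_iff by (simp_all add: field_simps)
  have c0: "0 < c" "c \<le> 1/32"
    using zero_less_card_finite[where 'a='n] by (auto simp: c divide_le_eq field_simps Suc_leI)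
  define n where "n = real CARD('n)"
  have n1: "1 \<le> n" by (simp add: n_def Suc_leI)
  have nc: "n * c \<le> 1/16" using n1 by (simp add: c n_def[symmetric] field_simps)
  have r4: "r\<^sup>2 \<le> 4" using power_mono[of r 2 2] r by simp
  have "(\<Sum>i\<in>UNIV - {k}. (cmod (x $ i))\<^sup>2) \<le> (\<Sum>i\<in>UNIV - {k}. 2 * c\<^sup>2 * r\<^sup>2)"
  proof (intro sum_mono)
    fix i assume "i \<in> UNIV - {k}"
    then have "(Re (x $ i))\<^sup>2 \<le> (c * r)\<^sup>2" "(Im (x $ i))\<^sup>2 \<le> (c * r)\<^sup>2"
      using j[of i] c0 r by (auto simp: abs_le_square_iff[symmetric])
    then show "(cmod (x $ i))\<^sup>2 \<le> 2 * c\<^sup>2 * r\<^sup>2" by (simp add: cmod_power2 power_mult_distrib)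
  qed
  also have "\<dots> = (n - 1) * (2 * c\<^sup>2 * r\<^sup>2)"
    by (simp add: card_Diff_subset n_def of_nat_diff Suc_leI)
  also have "\<dots> \<le> n * (2 * c\<^sup>2 * r\<^sup>2)" by (intro mult_right_mono) auto
  also have "\<dots> = (n * c) * (2 * c * r\<^sup>2)" by (simp add: power2_eq_square)
  also have "\<dots> \<le> 1/16 * (2 * c * r\<^sup>2)" using nc c0 by (intro mult_right_mono) auto
  finally have perp: "(norm x)\<^sup>2 \<le> (cmod (x $ k))\<^sup>2 + c * r\<^sup>2 / 8"
    unfolding norm_power2_eq_sum by (subst sum.remove[of _ k]) auto
  have k1: "cmod (x $ k) \<le> norm x" by (rule Finite_Cartesian_Product.norm_nth_le)
  have k2: "1/4 \<le> cmod (x $ k)" using complex_Re_le_cmod[of "x $ k"] re by linarith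
  have cr: "c * r\<^sup>2 \<le> 1/8" using mult_mono[of c "1/32" "r\<^sup>2" 4] c0 r4 by simp
  have k3: "cmod (x $ k) \<le> Re (x $ k) + c * r\<^sup>2"
    using cmod_le[of "x $ k"] re im by simp
  have "(norm x - cmod (x $ k)) * (1/2) \<le> (norm x - cmod (x $ k)) * (norm x + cmod (x $ k))"
    using k1 k2 by (intro mult_left_mono) auto
  also have "\<dots> \<le> c * r\<^sup>2 / 8" using perp by (simp add: algebra_simps power2_eq_square)
  finally have d1: "norm x \<le> cmod (x $ k) + c * r\<^sup>2 / 4" by simp
  have "cmod (norm x - x $ k) \<le> \<bar>Re (norm x - x $ k)\<bar> + \<bar>Im (norm x - x $ k)\<bar>"
    by (rule cmod_le)
  also have "\<dots> \<le> 3 * (c * r\<^sup>2)"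
    using d1 k1 k3 im complex_Re_le_cmod[of "x $ k"] mult_nonneg_nonneg[of c "r\<^sup>2"] c0 by simp
  finally have d: "cmod (norm x - x $ k) \<le> 3 * (c * r\<^sup>2)" .
  have x0: "x \<noteq> 0" "1/4 \<le> norm x" using k1 k2 by auto
  have "norm x * cmod (1 - x $ k / norm x) = cmod (norm x - x $ k)"
    by (rule norm_mult_one_minus_quotient[OF x0(1)])
  moreover have "1/4 * cmod (1 - x $ k / norm x) \<le> norm x * cmod (1 - x $ k / norm x)"
    using x0 by (intro mult_right_mono) auto
  ultimately have "cmod (1 - x $ k / norm x) \<le> 12 * (c * r\<^sup>2)" using d by linarith
  also have "\<dots> < r\<^sup>2" using c0 r by (simp add: field_simps)
  finally have "cmod (1 - x $ k / norm x) < r\<^sup>2" .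
  moreover have "norm x < 1" using d1 k3 re cr by linarith
  ultimately show "x \<in> coord_cone k r" using x0 by (simp add: coord_cone_def)
qed

text \<open>Inner and outer box both have volume a constant times
  \<open>r\<^sup>2 * r ^ (2 * CARD('n) - 2)\<close>. Radii stop at 2, where the ball is already the
  whole sphere.\<close>

lemma measure_nonisotropic_ball:
  obtains c C where "0 < c" "0 < C"
    "\<And>(u :: complex ^ 'n) r. norm u = 1 \<Longrightarrow> 0 < r \<Longrightarrow> r \<le> 2 \<Longrightarrow>
       c * r ^ (2 * CARD('n)) \<le> measure sphere_measure (nonisotropic_ball u r) \<and>
       measure sphere_measure (nonisotropic_ball u r) \<le> C * r ^ (2 * CARD('n))"
proof -
  define v where "v = measure lborel (ball 0 1 :: (complex ^ 'n) set)"
  have v: "emeasure lborel (ball 0 1 :: (complex ^ 'n) set) = ennreal v" "0 < v"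
    unfolding v_def
    using emeasure_lborel_ball_finite[of "0 :: complex ^ 'n" 1] content_ball_pos[of 1 "0 :: complex ^ 'n"]
    by (simp_all add: emeasure_eq_ennreal_measure less_top)
  obtain k :: 'n where True by simp
  define a where "a = 1 / (16 * (real CARD('n) + 1))"
  have a: "0 < a" by (simp add: a_def)
  define N where "N = 2 * CARD('n) - 2"
  have N: "2 * CARD('n) = N + 2" using zero_less_card_finite[where 'a='n] unfolding N_def by linarith
  have m: "emeasure sphere_measure (nonisotropic_ball u r) = ennreal (measure lborel (coord_cone k r) / v)"
    and l: "(4 * (1/8) * a * (2 * a) ^ N / v) * r ^ (2 * CARD('n)) \<le> measure lborel (coord_cone k r) / v"
    and h: "r \<le> 2 \<Longrightarrow> measure lborel (coord_cone k r) / v \<le> (4 * 4 ^ N / v) * r ^ (2 * CARD('n))"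
    if u: "norm u = 1" and r: "0 < r" "r \<le> 2" for u :: "complex ^ 'n" and r
  proof -
    note c = coord_box[of 1 "r\<^sup>2" "2 * r" k 0] coord_box[of "1/8" "a * r\<^sup>2" "a * r" k "3/8"]
    have up: "emeasure lborel (coord_cone k r) \<le> ennreal (4 * r\<^sup>2 * (4 * r) ^ N)"
      using emeasure_mono[OF coord_cone_subset_coord_box[OF r(1), of k], of lborel] c r by (simp add: N_def)
    then have e: "emeasure lborel (coord_cone k r) = ennreal (measure lborel (coord_cone k r))"
      by (intro emeasure_eq_ennreal_measure) (auto simp: top_unique)
    show "emeasure sphere_measure (nonisotropic_ball u r) = ennreal (measure lborel (coord_cone k r) / v)"
      unfolding emeasure_nonisotropic_ball[OF u r(1), of k] v(1) e
      by (rule divide_ennreal) (use v in auto)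
    have "measure lborel (coord_cone k r) \<le> 4 * r\<^sup>2 * (4 * r) ^ N"
      using up r unfolding e by (subst (asm) ennreal_le_iff) auto
    from divide_right_mono[OF this, of v] have "measure lborel (coord_cone k r) / v \<le> 4 * r\<^sup>2 * (4 * r) ^ N / v"
      using v by simp
    also have "\<dots> = (4 * 4 ^ N / v) * r ^ (2 * CARD('n))"
      unfolding N by (simp add: power_mult_distrib power_add power2_eq_square)
    finally show "measure lborel (coord_cone k r) / v \<le> (4 * 4 ^ N / v) * r ^ (2 * CARD('n))" .
    have "ennreal (4 * (1/8) * (a * r\<^sup>2) * (2 * (a * r)) ^ N) \<le> emeasure lborel (coord_cone k r)"
      using emeasure_mono[OF coord_box_subset_coord_cone[OF r a_def, of k], of lborel] c(4) a r by (simp add: N_def)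
    then have "4 * (1/8) * (a * r\<^sup>2) * (2 * (a * r)) ^ N \<le> measure lborel (coord_cone k r)"
      unfolding e by (subst (asm) ennreal_le_iff) auto
    from divide_right_mono[OF this, of v]
    have "4 * (1/8) * (a * r\<^sup>2) * (2 * (a * r)) ^ N / v \<le> measure lborel (coord_cone k r) / v"
      using v by simp
    moreover have "4 * (1/8) * (a * r\<^sup>2) * (2 * (a * r)) ^ N / v = (4 * (1/8) * a * (2 * a) ^ N / v) * r ^ (2 * CARD('n))"
      unfolding N by (simp add: power_mult_distrib power_add power2_eq_square)
    ultimately show "(4 * (1/8) * a * (2 * a) ^ N / v) * r ^ (2 * CARD('n)) \<le> measure lborel (coord_cone k r) / v"
      by (simp only:)
  qed
  show ?thesis
  proof (rule that)
    show "0 < 4 * (1/8) * a * (2 * a) ^ N / v" "0 < 4 * 4 ^ N / v"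
      using v a by auto
  next
    fix u :: "complex ^ 'n" and r :: real assume ur: "norm u = 1" "0 < r" "r \<le> 2"
    have "measure sphere_measure (nonisotropic_ball u r) = measure lborel (coord_cone k r) / v"
      unfolding measure_def m[OF ur] using v by simp
    then show "(4 * (1/8) * a * (2 * a) ^ N / v) * r ^ (2 * CARD('n)) \<le> measure sphere_measure (nonisotropic_ball u r) \<and>
       measure sphere_measure (nonisotropic_ball u r) \<le> (4 * 4 ^ N / v) * r ^ (2 * CARD('n))"
      using l[OF ur] h[OF ur ur(3)] by simp
  qed
qed

section \<open>Products of geometrically weighted sums\<close>

lemma conjugate_exponents:
  fixes p q :: real
  assumes "1 < p" "1 / p + 1 / q = 1"
  shows "1 < q" "(p - 1) * (q - 1) = 1" "q * (p - 1) = p" "p * (q - 1) = q"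
proof -
  \<comment> \<open>At \<open>q = 0\<close> the quotient \<open>1 / q\<close> is 0, which would
    force \<open>p = 1\<close>.\<close>
  have "q \<noteq> 0" using assms by auto
  then have e: "q + p = p * q" using assms by (simp add: field_simps)
  then show *: "(p - 1) * (q - 1) = 1" by (simp add: algebra_simps)
  then show "1 < q" using assms zero_less_mult_pos[of "p - 1" "q - 1"] by simp
  show "q * (p - 1) = p" "p * (q - 1) = q" using e by (simp_all add: algebra_simps)
qed

text \<open>After division by \<open>x + y\<close> both terms lie in the unit interval, where
  \<open>t \<le> t powr s\<close>.\<close>

lemma powr_add_le_add_powr:
  fixes x y s :: real
  assumes "0 \<le> x" "0 \<le> y" "0 < s" "s \<le> 1"
  shows "(x + y) powr s \<le> x powr s + y powr s"
proof (cases "x + y = 0")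
  case False
  define z where "z = x + y"
  have z: "0 < z" using False assms by (simp add: z_def)
  have "x / z \<le> (x / z) powr s" "y / z \<le> (y / z) powr s"
    using powr_mono'[of s 1 "x / z"] powr_mono'[of s 1 "y / z"] assms z by (simp_all add: z_def)
  moreover have "x / z + y / z = 1" using z by (simp add: z_def add_divide_distrib[symmetric])
  ultimately have "1 \<le> (x / z) powr s + (y / z) powr s" by linarith
  from mult_left_mono[OF this, of "z powr s"] show ?thesis
    using z assms by (simp add: powr_divide distrib_left z_def[symmetric])
qed (use assms in auto)

lemma powr_sum_le_sum_powr:
  fixes f :: "'a \<Rightarrow> real"
  assumes "finite I" "\<And>i. i \<in> I \<Longrightarrow> 0 \<le> f i" "0 < s" "s \<le> 1"
  shows "(\<Sum>i\<in>I. f i) powr s \<le> (\<Sum>i\<in>I. f i powr s)"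
  using assms(1,2)
proof (induction I rule: finite_induct)
  case (insert i I)
  then have "(f i + sum f I) powr s \<le> f i powr s + sum f I powr s"
    by (intro powr_add_le_add_powr assms(3,4) sum_nonneg) auto
  then show ?case using insert by simp
qed simp

text \<open>This is the weighted arithmetic-geometric mean inequality for \<open>1 - d\<close> and 1
  with weights \<open>s\<close> and \<open>1 - s\<close>.\<close>

lemma powr_one_minus_le:
  fixes d s :: real
  assumes "0 \<le> d" "d < 1" "0 \<le> s" "s \<le> 1"
  shows "(1 - d) powr s \<le> 1 - s * d"
  using Youngs_inequality_0[of s "1 - s" "1 - d" 1] assms by (simp add: algebra_simps)

lemma power_powr_commute:
  fixes x s :: real
  assumes "0 < x"
  shows "(x ^ n) powr s = (x powr s) ^ n"
  using assms by (induction n) (simp_all add: powr_mult)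

lemma sum_power_diff_le:
  fixes x :: real
  assumes "0 \<le> x" "x < 1"
  shows "(\<Sum>i\<le>k. x ^ (k - i)) \<le> 1 / (1 - x)"
proof -
  have "(\<Sum>i\<le>k. x ^ (k - i)) = (\<Sum>i\<le>k. x ^ i)"
    by (rule sum.reindex_bij_witness[of _ "\<lambda>i. k - i" "\<lambda>i. k - i"]) auto
  also have "\<dots> \<le> 1 / (1 - x)"
    using assms sum_gp0[of x k] by (simp add: divide_right_mono)
  finally show ?thesis .
qed

lemma sum_power_le_last:
  fixes x :: real
  assumes "2 \<le> x"
  shows "(\<Sum>k\<le>n. x ^ k) \<le> 2 * x ^ n"
proof (induction n)
  case (Suc n)
  have "2 * x ^ n \<le> x * x ^ n" using assms by (intro mult_right_mono) auto
  then show ?case using Suc by simp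
qed simp

lemma geometric_decay:
  fixes f :: "nat \<Rightarrow> real"
  assumes "\<And>j. j < N \<Longrightarrow> f (Suc j) \<le> c * f j" "0 \<le> c" "i \<le> k" "k \<le> N"
  shows "f k \<le> c ^ (k - i) * f i"
  using assms(3,4)
proof (induction k rule: dec_induct)
  case (step k)
  have "f (Suc k) \<le> c * f k" using step assms(1) by simp
  also have "\<dots> \<le> c * (c ^ (k - i) * f i)" using step assms(2) by (intro mult_left_mono) auto
  finally show ?case using step by (simp add: Suc_diff_le)
qed simp

text \<open>With \<open>powr s\<close> taken inside the second sum, the product becomes a double
  sum. The bound \<open>A * K\<close> on its diagonal spreads to the other terms: for
  \<open>i < k\<close> the decay of \<open>V\<close> leads from \<open>V k\<close> back to
  \<open>V i\<close>, for \<open>k < i\<close> the decay of \<open>W\<close> from \<open>W i\<close>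
  back to \<open>W k\<close>. The geometric series in the distance of the indices cost a multiple of
  \<open>A powr (1 / s)\<close>, and the remaining sum of \<open>E ^ k\<close> is dominated by its
  last term.\<close>

lemma weighted_sums_product_le_aux:
  fixes W V :: "nat \<Rightarrow> real"
  assumes s: "0 < s" "s \<le> 1" and E: "2 \<le> E" and F: "0 < F" "F powr s = E"
    and A: "1 \<le> A" and K: "0 < K" and ab: "0 < a" "a \<le> 1" "0 < b" "b < 1"
    and pos: "\<And>k. k \<le> N \<Longrightarrow> 0 < W k" "\<And>k. k \<le> N \<Longrightarrow> 0 < V k"
    and WV: "\<And>k. k \<le> N \<Longrightarrow> W k * V k powr s \<le> A * K / E ^ k"
    and W: "\<And>k. k < N \<Longrightarrow> W (Suc k) \<le> (1 - a / A) * W k"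
    and V: "\<And>k. k < N \<Longrightarrow> V (Suc k) \<le> (1 - b / A powr (1 / s)) * V k"
  shows "(\<Sum>k\<le>N. E ^ k * W k) * (\<Sum>k\<le>N. F ^ k * V k) powr s
    \<le> 2 * K * (1 / (s * b) + 1 / a) * A powr (1 + 1 / s) * E ^ N"
proof -
  define At where "At = A powr (1 / s)"
  have At1: "1 \<le> At" using A s by (simp add: At_def ge_one_powr_ge_zero)
  have At: "A \<le> At" using A s powr_mono[of 1 "1 / s" A] by (simp add: At_def)
  \<comment> \<open>In one step \<open>W\<close> shrinks at least by the factor
    \<open>\<tau>\<close> and \<open>V powr s\<close> by \<open>\<rho>\<close>; their distances from
    1 control the geometric series.\<close>
  define \<tau> \<rho> where "\<tau> = 1 - a / A" and "\<rho> = (1 - b / At) powr s"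
  have \<tau>: "0 \<le> \<tau>" "\<tau> < 1" using A ab by (auto simp: \<tau>_def field_simps)
  have bA: "0 < b / At" "b / At < 1" using At1 ab by (auto simp: field_simps)
  have \<rho>0: "0 \<le> \<rho>" by (simp add: \<rho>_def)
  have \<rho>1: "s * b / At \<le> 1 - \<rho>"
    using powr_one_minus_le[of "b / At" s] bA s by (simp add: \<rho>_def)
  have sb: "0 < s * b / At" using s ab At1 by simp
  have \<rho>: "\<rho> < 1" using \<rho>1 sb by linarith
  have \<rho>2: "1 / (1 - \<rho>) \<le> At / (s * b)"
    using le_imp_inverse_le[OF \<rho>1 sb] by (simp add: divide_inverse mult_ac)
  have \<tau>2: "1 / (1 - \<tau>) \<le> At / a"
    using At ab by (simp add: \<tau>_def divide_right_mono)
  \<comment> \<open>\<open>?g\<close> bounds the terms with \<open>i \<le> k\<close> and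
    \<open>?h\<close> those with \<open>k \<le> i\<close>. The diagonal is charged to both, which is
    harmless in an upper bound.\<close>
  let ?t = "\<lambda>i k. (E ^ i * W i) * (E ^ k * V k powr s)"
  let ?g = "\<lambda>i k. (if i \<le> k then A * K * E ^ k * \<rho> ^ (k - i) else 0)"
  let ?h = "\<lambda>i k. (if k \<le> i then A * K * E ^ i * \<tau> ^ (i - k) else 0)"
  have g0: "0 \<le> ?g i k" and h0: "0 \<le> ?h i k" for i k
    using A K E \<rho>0 \<tau> by auto
  have diag: "E ^ k * W k * V k powr s \<le> A * K" if "k \<le> N" for k
    using WV[OF that] E by (simp add: field_simps)
  have term_le: "?t i k \<le> ?g i k + ?h i k" if i: "i \<le> N" and k: "k \<le> N" for i k
  proof (cases "i \<le> k")
    case True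
    have "V k \<le> (1 - b / At) ^ (k - i) * V i"
      using V bA True k by (intro geometric_decay[of N V]) (auto simp: At_def)
    then have "V k powr s \<le> ((1 - b / At) ^ (k - i) * V i) powr s"
      using pos(2)[OF k] s by (intro powr_mono2) auto
    also have "\<dots> = \<rho> ^ (k - i) * V i powr s"
      using bA pos(2)[OF i] unfolding \<rho>_def
      by (simp add: powr_mult power_powr_commute)
    finally have "?t i k \<le> (E ^ i * W i) * (E ^ k * (\<rho> ^ (k - i) * V i powr s))"
      using E pos(1)[OF i] by (intro mult_left_mono) auto
    also have "\<dots> = (E ^ i * W i * V i powr s) * (E ^ k * \<rho> ^ (k - i))" by simp
    also have "\<dots> \<le> (A * K) * (E ^ k * \<rho> ^ (k - i))"
      using diag[OF i] E \<rho>0 by (intro mult_right_mono) auto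
    finally show ?thesis using True h0[of k i] by (simp add: mult.assoc)
  next
    case False
    have "W i \<le> \<tau> ^ (i - k) * W k"
      using W \<tau> False i by (intro geometric_decay[of N W]) (auto simp: \<tau>_def)
    then have "?t i k \<le> (E ^ i * (\<tau> ^ (i - k) * W k)) * (E ^ k * V k powr s)"
      using E by (intro mult_right_mono mult_left_mono) auto
    also have "\<dots> = (E ^ k * W k * V k powr s) * (E ^ i * \<tau> ^ (i - k))" by simp
    also have "\<dots> \<le> (A * K) * (E ^ i * \<tau> ^ (i - k))"
      using diag[OF k] E \<tau> by (intro mult_right_mono) auto
    finally show ?thesis using False by (simp add: mult.assoc)
  qed
  have sum_le: "(\<Sum>k\<le>N. \<Sum>i\<le>N. if i \<le> k then A * K * E ^ k * x ^ (k - i) else 0) \<le> A * K * (2 * E ^ N) * y"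
    if x: "0 \<le> x" "x < 1" "1 / (1 - x) \<le> y" for x y :: real
  proof -
    have "(\<Sum>i\<le>N. if i \<le> k then A * K * E ^ k * x ^ (k - i) else 0) \<le> A * K * E ^ k * y" if "k \<le> N" for k
    proof -
      have "(\<Sum>i\<le>N. if i \<le> k then A * K * E ^ k * x ^ (k - i) else 0) = (\<Sum>i\<in>{..k}. A * K * E ^ k * x ^ (k - i))"
        using that by (intro sum.mono_neutral_cong_right) auto
      also have "\<dots> = A * K * E ^ k * (\<Sum>i\<le>k. x ^ (k - i))" by (simp add: sum_distrib_left)
      also have "\<dots> \<le> A * K * E ^ k * y"
        using sum_power_diff_le[OF x(1,2), of k] x(3) A K E by (intro mult_left_mono) auto
      finally show ?thesis .
    qed
    then have "(\<Sum>k\<le>N. \<Sum>i\<le>N. if i \<le> k then A * K * E ^ k * x ^ (k - i) else 0) \<le> (\<Sum>k\<le>N. A * K * E ^ k * y)"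
      by (intro sum_mono) auto
    also have "\<dots> = A * K * (\<Sum>k\<le>N. E ^ k) * y" by (simp add: sum_distrib_left sum_distrib_right)
    also have "\<dots> \<le> A * K * (2 * E ^ N) * y"
    proof (intro mult_right_mono mult_left_mono sum_power_le_last E)
      have "0 \<le> 1 / (1 - x)" using x by simp
      then show "0 \<le> y" using x(3) by linarith
    qed (use A K in auto)
    finally show ?thesis .
  qed
  have "(\<Sum>k\<le>N. F ^ k * V k) powr s \<le> (\<Sum>k\<le>N. (F ^ k * V k) powr s)"
    using F pos(2) s by (intro powr_sum_le_sum_powr) (auto simp: less_imp_le)
  also have "\<dots> = (\<Sum>k\<le>N. E ^ k * V k powr s)"
  proof (intro sum.cong refl)
    fix k
    have "(F ^ k) powr s = E ^ k"
      using F by (simp add: F(2)[symmetric] powr_power powr_realpow[symmetric] powr_powr mult.commute)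
    then show "(F ^ k * V k) powr s = E ^ k * V k powr s" if "k \<in> {..N}"
      using F pos(2)[of k] that by (simp add: powr_mult)
  qed
  finally have "(\<Sum>k\<le>N. E ^ k * W k) * (\<Sum>k\<le>N. F ^ k * V k) powr s
      \<le> (\<Sum>k\<le>N. E ^ k * W k) * (\<Sum>k\<le>N. E ^ k * V k powr s)"
    using E pos(1) by (intro mult_left_mono sum_nonneg) (auto simp: less_imp_le)
  also have "\<dots> = (\<Sum>i\<le>N. \<Sum>k\<le>N. ?t i k)" by (simp add: sum_product)
  also have "\<dots> \<le> (\<Sum>i\<le>N. \<Sum>k\<le>N. ?g i k + ?h i k)"
    by (intro sum_mono term_le) auto
  \<comment> \<open>Each double sum is arranged with the larger index outside, so that
    \<open>sum_le\<close> applies to both.\<close>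
  also have "\<dots> = (\<Sum>k\<le>N. \<Sum>i\<le>N. ?g i k) + (\<Sum>i\<le>N. \<Sum>k\<le>N. ?h i k)"
    by (simp only: sum.distrib) (subst sum.swap, rule refl)
  also have "\<dots> \<le> A * K * (2 * E ^ N) * (At / (s * b)) + A * K * (2 * E ^ N) * (At / a)"
    using sum_le[OF \<rho>0 \<rho> \<rho>2] sum_le[OF \<tau> \<tau>2] by (rule add_mono)
  also have "\<dots> = 2 * K * (1 / (s * b) + 1 / a) * (A * At) * E ^ N"
    by (simp add: algebra_simps)
  also have "A * At = A powr (1 + 1 / s)" using A by (simp add: At_def powr_add)
  finally show ?thesis .
qed

text \<open>For \<open>p \<le> 2\<close> the power \<open>p - 1\<close> is subadditive and can be taken inside the sum; for \<open>p > 2\<close>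
  the roles of \<open>W\<close> and \<open>V\<close> are exchanged, which replaces \<open>A\<close> by \<open>A powr (q - 1)\<close>.\<close>
lemma weighted_sums_product_le:
  fixes p q D K a b :: real
  assumes p: "1 < p" and pq: "1 / p + 1 / q = 1" and D: "2 \<le> D" and K: "0 < K"
    and ab: "0 < a" "a < 1" "0 < b" "b < 1"
  obtains C where "0 < C"
    "\<And>A N W V. 1 \<le> A \<Longrightarrow>
      (\<And>k. k \<le> N \<Longrightarrow> 0 < W k) \<Longrightarrow> (\<And>k. k \<le> N \<Longrightarrow> 0 < V k) \<Longrightarrow>
      (\<And>k. k \<le> N \<Longrightarrow> W k * V k powr (p - 1) \<le> A * K / (D powr p) ^ k) \<Longrightarrow>
      (\<And>k. k < N \<Longrightarrow> W (Suc k) \<le> (1 - a / A) * W k) \<Longrightarrow>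
      (\<And>k. k < N \<Longrightarrow> V (Suc k) \<le> (1 - b / A powr (q - 1)) * V k) \<Longrightarrow>
      (\<Sum>k\<le>N. (D powr p) ^ k * W k) * (\<Sum>k\<le>N. (D powr q) ^ k * V k) powr (p - 1)
        \<le> C * A powr max p q * (D powr p) ^ N"
proof -
  note q = conjugate_exponents(1)[OF p pq] and qp = conjugate_exponents(3)[OF p pq]
    and pq' = conjugate_exponents(4)[OF p pq]
  have q1: "q - 1 = 1 / (p - 1)" and p1: "p - 1 = 1 / (q - 1)"
    using conjugate_exponents(2)[OF p pq] p q by (simp_all add: field_simps)
  have ge2: "2 \<le> D powr x" if "1 < x" for x
    using powr_mono[of 1 x D] D that by simp
  show thesis
  proof (cases "p \<le> 2")
    case True
    \<comment> \<open>For \<open>p \<le> 2\<close> the larger exponent is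
      \<open>q = 1 + 1 / (p - 1)\<close>, the power of \<open>A\<close> in the auxiliary estimate
      with \<open>s = p - 1\<close>.\<close>
    have mx: "max p q = 1 + 1 / (p - 1)"
    proof -
      have "1 \<le> q - 1" unfolding q1 using p True by simp
      then show ?thesis using q1 True by simp
    qed
    show thesis
    proof (rule that[of "2 * K * (1 / ((p - 1) * b) + 1 / a)"])
      show "0 < 2 * K * (1 / ((p - 1) * b) + 1 / a)" using K p ab by (simp add: add_pos_pos)
    next
      fix A :: real and N :: nat and W V :: "nat \<Rightarrow> real"
      assume "1 \<le> A" "\<And>k. k \<le> N \<Longrightarrow> 0 < W k" "\<And>k. k \<le> N \<Longrightarrow> 0 < V k"
        "\<And>k. k \<le> N \<Longrightarrow> W k * V k powr (p - 1) \<le> A * K / (D powr p) ^ k"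
        "\<And>k. k < N \<Longrightarrow> W (Suc k) \<le> (1 - a / A) * W k"
        "\<And>k. k < N \<Longrightarrow> V (Suc k) \<le> (1 - b / A powr (q - 1)) * V k"
      then show "(\<Sum>k\<le>N. (D powr p) ^ k * W k) * (\<Sum>k\<le>N. (D powr q) ^ k * V k) powr (p - 1)
          \<le> 2 * K * (1 / ((p - 1) * b) + 1 / a) * A powr max p q * (D powr p) ^ N"
        unfolding mx using p True K ab D ge2[OF p]
        by (intro weighted_sums_product_le_aux) (auto simp: powr_powr qp q1)
    qed
  next
    case False
    have mx: "max p q = p"
    proof -
      have "q - 1 \<le> 1" unfolding q1 using False by simp
      then show ?thesis using False by simp
    qed
    have q2: "q - 1 \<le> 1" unfolding q1 using False by simp
    define C where "C = 2 * K powr (q - 1) * (1 / ((q - 1) * a) + 1 / b)"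
    have C: "0 < C" unfolding C_def using K q ab by (simp add: add_pos_pos)
    show thesis
    proof (rule that[of "C powr (p - 1)"])
      show "0 < C powr (p - 1)" using C by simp
    next
      fix A :: real and N :: nat and W V :: "nat \<Rightarrow> real"
      assume A: "1 \<le> A" and W0: "\<And>k. k \<le> N \<Longrightarrow> 0 < W k" and V0: "\<And>k. k \<le> N \<Longrightarrow> 0 < V k"
        and WV: "\<And>k. k \<le> N \<Longrightarrow> W k * V k powr (p - 1) \<le> A * K / (D powr p) ^ k"
        and W: "\<And>k. k < N \<Longrightarrow> W (Suc k) \<le> (1 - a / A) * W k"
        and V: "\<And>k. k < N \<Longrightarrow> V (Suc k) \<le> (1 - b / A powr (q - 1)) * V k"
      let ?X = "\<Sum>k\<le>N. (D powr p) ^ k * W k" and ?Y = "\<Sum>k\<le>N. (D powr q) ^ k * V k"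
      have X: "0 \<le> ?X" and Y: "0 \<le> ?Y" using W0 V0 D by (auto intro!: sum_nonneg simp: less_imp_le)
      have pow: "(D powr p) ^ k = D powr (p * real k)" "(D powr q) ^ k = D powr (q * real k)" for k
        using D by (simp_all add: powr_power powr_realpow[symmetric] powr_powr)
      have m1: "(p - 1) * (q - 1) = 1" using p1 q by simp
      have "?Y * ?X powr (q - 1) \<le> 2 * K powr (q - 1) * (1 / ((q - 1) * a) + 1 / b) *
          (A powr (q - 1)) powr (1 + 1 / (q - 1)) * (D powr q) ^ N"
      proof (rule weighted_sums_product_le_aux)
        show "V k * W k powr (q - 1) \<le> A powr (q - 1) * K powr (q - 1) / (D powr q) ^ k" if "k \<le> N" for k
        proof -
          have "(W k * V k powr (p - 1)) powr (q - 1) \<le> (A * K / (D powr p) ^ k) powr (q - 1)"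
            using WV[OF that] W0[OF that] q by (intro powr_mono2) auto
          moreover have "(q - 1) * (p * real k) = p * (q - 1) * real k" by simp
          then have "(q - 1) * (p * real k) = q * real k" by (simp only: pq')
          ultimately show ?thesis
            using W0[OF that] V0[OF that] A K D
            by (simp add: powr_mult powr_divide powr_powr pow m1 mult.commute)
        qed
        show "1 \<le> A powr (q - 1)" using A q by (simp add: ge_one_powr_ge_zero)
        show "W (Suc k) \<le> (1 - a / (A powr (q - 1)) powr (1 / (q - 1))) * W k" if "k < N" for k
          using W[OF that] A q by (simp add: powr_powr)
        show "(D powr p) powr (q - 1) = D powr q" by (simp add: powr_powr pq')
      qed (use q q2 ge2[OF q] D K ab W0 V0 V in auto)
      also have "\<dots> = C * A powr q * (D powr q) ^ N"
        using q A by (simp add: C_def powr_powr distrib_left)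
      finally have le: "?Y * ?X powr (q - 1) \<le> C * A powr q * (D powr q) ^ N" .
      \<comment> \<open>Raising to the power \<open>p - 1\<close> undoes the exchange of the two
        sums, as \<open>(p - 1) * (q - 1) = 1\<close>, and turns \<open>A powr q\<close> into
        \<open>A powr p\<close>.\<close>
      have "?X * ?Y powr (p - 1) = (?Y * ?X powr (q - 1)) powr (p - 1)"
        using X Y m1 by (simp add: powr_mult powr_powr mult.commute)
      also have "\<dots> \<le> (C * A powr q * (D powr q) ^ N) powr (p - 1)"
        using le X Y p by (intro powr_mono2) auto
      also have "\<dots> = C powr (p - 1) * A powr p * (D powr p) ^ N"
      proof -
        have "q * real N * (p - 1) = q * (p - 1) * real N" by simp
        then have e: "q * real N * (p - 1) = p * real N" by (simp only: qp)
        show ?thesis using C A D by (simp add: powr_mult powr_powr pow qp) (simp only: e)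
      qed
      finally show "?X * ?Y powr (p - 1) \<le> C powr (p - 1) * A powr max p q * (D powr p) ^ N"
        unfolding mx .
    qed
  qed
qed

section \<open>Averages of weights over non-isotropic balls\<close>

lemma ennreal_powr_ennreal: "0 \<le> x \<Longrightarrow> ennreal_powr (ennreal x) a = ennreal (x powr a)"
  by (simp add: ennreal_powr_def)

lemma ennreal_powr_mono:
  assumes "x \<le> y" "0 \<le> a"
  shows "ennreal_powr x a \<le> ennreal_powr y a"
proof (cases y)
  case (real s)
  moreover obtain r where "x = ennreal r" "0 \<le> r" using assms real by (cases x) (auto simp: top_unique)
  ultimately show ?thesis using assms by (simp add: ennreal_powr_ennreal powr_mono2)
qed (simp add: ennreal_powr_def)

lemma ennreal_powr_mult:
  assumes "0 < c"
  shows "ennreal_powr (ennreal c * x) a = ennreal (c powr a) * ennreal_powr x a"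
proof (cases x)
  case (real r)
  then show ?thesis using assms
    by (simp add: ennreal_powr_ennreal powr_mult flip: ennreal_mult)
qed (use assms in \<open>simp add: ennreal_powr_def ennreal_mult_top\<close>)

lemma ennreal_powr_eq_0_iff: "ennreal_powr x a = 0 \<longleftrightarrow> x = 0"
proof (cases x)
  case (real r)
  then show ?thesis by (simp add: ennreal_powr_ennreal)
qed (simp add: ennreal_powr_def)

section \<open>Hoelder's inequality for a weight and its dual\<close>

lemma set_nn_integral_pos:
  assumes "E \<in> sets M" "w \<in> borel_measurable M" "AE x in M. 0 < (w x :: real)" "emeasure M E \<noteq> 0"
  shows "(\<integral>\<^sup>+ x \<in> E. ennreal (w x) \<partial>M) \<noteq> 0"
proof
  assume "(\<integral>\<^sup>+ x \<in> E. ennreal (w x) \<partial>M) = 0"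
  then have "AE x in M. ennreal (w x) * indicator E x = 0"
    using assms by (subst (asm) nn_integral_0_iff_AE) auto
  with assms(3) have "AE x in M. x \<notin> E"
    by eventually_elim (auto split: split_indicator_asm simp: ennreal_eq_0_iff)
  then show False using assms by (simp add: AE_iff_null_sets[OF assms(1), symmetric] null_sets_def)
qed

text \<open>Hoelder's inequality for the constant 1, written as \<open>w powr (1 / p)\<close> times
  the \<open>1 / q\<close>-th power of the dual weight. It comes from integrating the pointwise
  Young inequality for the two weights divided by \<open>a\<close> and \<open>b\<close>.\<close>

lemma Hoelder_dual_weights:
  fixes w :: "'a \<Rightarrow> real" and p q :: real
  assumes p: "1 < p" "1 / p + 1 / q = 1"
    and E: "E \<in> sets M" "emeasure M E = ennreal m" "0 \<le> m"
    and w: "w \<in> borel_measurable M" "AE x in M. 0 < w x"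
    and a: "(\<integral>\<^sup>+ x \<in> E. ennreal (w x) \<partial>M) = ennreal a" "0 \<le> a"
    and b: "(\<integral>\<^sup>+ x \<in> E. ennreal (w x powr (- (1 / (p - 1)))) \<partial>M) = ennreal b" "0 \<le> b"
  shows "m powr p \<le> a * b powr (p - 1)"
proof (cases "m = 0")
  case False
  then have m: "0 < m" using E by simp
  note q = conjugate_exponents(1)[OF p]
  have pq1: "1 / q * p = p - 1" "1 / q / (p - 1) = 1 / p"
  proof -
    have "1 / q = 1 - 1 / p" using p by linarith
    then show "1 / q * p = p - 1" using p by (simp add: field_simps)
    show "1 / q / (p - 1) = 1 / p" using conjugate_exponents(3)[OF p] by simp
  qed
  note [measurable] = E(1) w(1)
  have a0: "0 < a" using set_nn_integral_pos[OF E(1) w] a E m by (auto simp: less_le)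
  have "AE x in M. 0 < w x powr (- (1 / (p - 1)))" using w(2) by eventually_elim simp
  then have b0: "0 < b"
    using set_nn_integral_pos[OF E(1), of "\<lambda>x. w x powr (- (1 / (p - 1)))"] b E m by (auto simp: less_le)
  \<comment> \<open>\<open>c\<close> is the reciprocal of the bound sought for \<open>m\<close>, so
    the aim is \<open>c * m \<le> 1\<close>.\<close>
  define c where "c = 1 / (a powr (1 / p) * b powr (1 / q))"
  have c: "0 < c" using a0 b0 by (simp add: c_def)
  have "ennreal (c * m) = (\<integral>\<^sup>+ x \<in> E. ennreal c \<partial>M)"
    using E c by (simp add: nn_integral_cmult_indicator ennreal_mult)
  also have "\<dots> \<le> (\<integral>\<^sup>+ x. ennreal (1 / (p * a)) * (ennreal (w x) * indicator E x) +
      ennreal (1 / (q * b)) * (ennreal (w x powr (- (1 / (p - 1)))) * indicator E x) \<partial>M)"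
    using w(2)
  proof (intro nn_integral_mono_AE, eventually_elim)
    case (elim x)
    define y where "y = w x powr (- (1 / (p - 1)))"
    have y: "0 < y" using elim by (simp add: y_def)
    have "w x powr (1 / p) * y powr (1 / q) = 1"
      using elim pq1(2) by (simp add: y_def powr_powr powr_add[symmetric] mult.commute)
    then have "c = (w x / a) powr (1 / p) * (y / b) powr (1 / q)"
      using elim y a0 b0 by (simp add: c_def powr_divide field_simps)
    also have "\<dots> \<le> 1 / p * (w x / a) + 1 / q * (y / b)"
      using elim y a0 b0 p q by (intro Youngs_inequality_0) auto
    finally have "c \<le> 1 / (p * a) * w x + 1 / (q * b) * y" by simp
    then have "ennreal c \<le> ennreal (1 / (p * a)) * ennreal (w x) + ennreal (1 / (q * b)) * ennreal y"
      using elim y a0 b0 p q by (simp add: ennreal_leI flip: ennreal_mult ennreal_plus)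
    then show ?case unfolding y_def by (simp split: split_indicator)
  qed
  also have "\<dots> = ennreal (1 / (p * a)) * ennreal a + ennreal (1 / (q * b)) * ennreal b"
    by (simp add: nn_integral_add nn_integral_cmult a b)
  also have "\<dots> = ennreal (1 / p + 1 / q)"
    using a0 b0 p q by (simp flip: ennreal_mult ennreal_plus)
  finally have "c * m \<le> 1" using p by (simp add: ennreal_le_1)
  then have "m \<le> a powr (1 / p) * b powr (1 / q)" using a0 b0 by (simp add: c_def)
  then have "m powr p \<le> (a powr (1 / p) * b powr (1 / q)) powr p" using p m by (intro powr_mono2) auto
  also have "\<dots> = a * b powr (p - 1)" using a0 b0 p pq1(1) by (simp add: powr_mult powr_powr)
  finally show ?thesis .
qed (use assms in simp)

section \<open>Balls, weights and averages on the sphere\<close>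

lemma finite_measure_sphere_measure: "finite_measure (sphere_measure :: (complex ^ 'n) measure)"
  by (rule finite_measureI) (simp add: emeasure_sphere_measure_space)

lemma nonisotropic_ball_sets [measurable]: "nonisotropic_ball u r \<in> sets (sphere_measure :: (complex ^ 'n) measure)"
proof -
  have "nonisotropic_ball u r \<subseteq> sphere 0 1" by (auto simp: nonisotropic_ball_def)
  then show ?thesis
    unfolding sphere_measure_def using nonisotropic_ball_borel[of u r]
    by (intro sets_completionI_sets) (auto simp: sets_restrict_space)
qed

lemma nonisotropic_ball_mono: "r \<le> s \<Longrightarrow> nonisotropic_ball u r \<subseteq> nonisotropic_ball u s"
  by (auto simp: nonisotropic_ball_def)

lemma nonisotropic_ball_eq_sphere:
  assumes "norm u = 1" "2 \<le> r"
  shows "nonisotropic_ball u r = sphere 0 1"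
proof -
  have "sqrt (cmod (1 - herm \<zeta> u)) < r" if "norm \<zeta> = 1" for \<zeta>
  proof -
    have "cmod (1 - herm \<zeta> u) \<le> 1 + 1"
      using norm_triangle_ineq4[of 1 "herm \<zeta> u"] norm_herm_le[of \<zeta> u] that assms by simp
    then have "sqrt (cmod (1 - herm \<zeta> u)) \<le> sqrt 2" by simp
    also have "\<dots> < r" using real_sqrt_less_iff[of 2 "2\<^sup>2"] assms by simp
    finally show ?thesis .
  qed
  then show ?thesis by (auto simp: nonisotropic_ball_def)
qed

lemma measure_nonisotropic_ball_pos:
  assumes "norm (u :: complex ^ 'n) = 1" "0 < r"
  shows "0 < measure sphere_measure (nonisotropic_ball u r)"
proof -
  interpret finite_measure "sphere_measure :: (complex ^ 'n) measure" by (rule finite_measure_sphere_measure)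
  obtain c C where c: "0 < c"
    "\<And>(u :: complex ^ 'n) r. norm u = 1 \<Longrightarrow> 0 < r \<Longrightarrow> r \<le> 2 \<Longrightarrow>
       c * r ^ (2 * CARD('n)) \<le> measure sphere_measure (nonisotropic_ball u r) \<and>
       measure sphere_measure (nonisotropic_ball u r) \<le> C * r ^ (2 * CARD('n))"
    using measure_nonisotropic_ball[where 'n='n] by metis
  have "0 < c * min r 2 ^ (2 * CARD('n))" using c assms by simp
  also have "\<dots> \<le> measure sphere_measure (nonisotropic_ball u (min r 2))" using c(2) assms by simp
  also have "\<dots> \<le> measure sphere_measure (nonisotropic_ball u r)"
    by (intro finite_measure_mono nonisotropic_ball_mono) auto
  finally show ?thesis .
qed

lemma weight_dual:
  assumes "weight w"
  shows "weight (\<lambda>\<zeta>. w \<zeta> powr a)"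
  using assms by (auto simp: weight_def elim: eventually_mono)

lemma average_pos:
  fixes u :: "complex ^ 'n"
  assumes "weight w" "norm u = 1" "0 < r"
  shows "average (nonisotropic_ball u r) w \<noteq> 0"
proof -
  interpret finite_measure "sphere_measure :: (complex ^ 'n) measure" by (rule finite_measure_sphere_measure)
  show ?thesis
    using set_nn_integral_pos[of "nonisotropic_ball u r" sphere_measure w] assms
      measure_nonisotropic_ball_pos[OF assms(2,3)]
    by (auto simp: average_def weight_def ennreal_divide_eq_0_iff emeasure_eq_measure)
qed

text \<open>Turns the condition on one ball into a statement about real numbers. Both averages are
  nonzero because the weights are positive almost everywhere, so a finite product forces each factor
  to be finite.\<close>

lemma Ap_norm_ball:
  fixes u :: "complex ^ 'n"
  assumes w: "weight w" and p: "1 < p" and A: "Ap_norm p w = ennreal A" "0 \<le> A"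
    and u: "norm u = 1" and r: "0 < r"
  obtains a b where "0 < a" "0 < b"
    "(\<integral>\<^sup>+ \<zeta> \<in> nonisotropic_ball u r. ennreal (w \<zeta>) \<partial>sphere_measure) = ennreal a"
    "(\<integral>\<^sup>+ \<zeta> \<in> nonisotropic_ball u r. ennreal (w \<zeta> powr (- (1 / (p - 1)))) \<partial>sphere_measure) = ennreal b"
    "a * b powr (p - 1) \<le> A * measure sphere_measure (nonisotropic_ball u r) powr p"
proof -
  interpret finite_measure "sphere_measure :: (complex ^ 'n) measure" by (rule finite_measure_sphere_measure)
  let ?B = "nonisotropic_ball u r" and ?v = "\<lambda>\<zeta>. w \<zeta> powr (- (1 / (p - 1)))"
  define m where "m = measure sphere_measure ?B"
  have m: "0 < m" "emeasure sphere_measure ?B = ennreal m"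
    using measure_nonisotropic_ball_pos[OF u r] by (simp_all add: m_def emeasure_eq_measure)
  have nz: "average ?B w \<noteq> 0" "average ?B ?v \<noteq> 0"
    using average_pos[OF w u r] average_pos[OF weight_dual[OF w] u r] by auto
  have le: "average ?B w * ennreal_powr (average ?B ?v) (p - 1) \<le> ennreal A"
    unfolding A(1)[symmetric] Ap_norm_def by (rule SUP_upper) (use u r in auto)
  have "ennreal_powr (average ?B ?v) (p - 1) \<noteq> 0" using nz(2) by (simp add: ennreal_powr_eq_0_iff)
  then have "average ?B w \<noteq> \<infinity>" using le by (auto simp: ennreal_top_mult top_unique)
  moreover have "average ?B ?v \<noteq> \<infinity>"
    using le nz(1) by (auto simp: ennreal_powr_def ennreal_mult_top top_unique)
  ultimately obtain \<alpha> \<beta> where \<alpha>: "average ?B w = ennreal \<alpha>" "0 \<le> \<alpha>" and \<beta>: "average ?B ?v = ennreal \<beta>" "0 \<le> \<beta>"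
    by (metis ennreal_cases infinity_ennreal_def)
  have pos: "0 < \<alpha>" "0 < \<beta>" using \<alpha> \<beta> nz by (auto simp: less_le)
  have eq: "(\<integral>\<^sup>+ \<zeta> \<in> ?B. ennreal (h \<zeta>) \<partial>sphere_measure) = ennreal (x * m)"
    if "average ?B h = ennreal x" "0 \<le> x" for h x
  proof -
    have "(\<integral>\<^sup>+ \<zeta> \<in> ?B. ennreal (h \<zeta>) \<partial>sphere_measure) = average ?B h * ennreal m"
      using m unfolding average_def by (simp add: ennreal_divide_times ennreal_mult_divide_eq)
    then show ?thesis using that m by (simp add: ennreal_mult)
  qed
  show thesis
  proof (rule that[of "\<alpha> * m" "\<beta> * m"])
    have "\<alpha> * \<beta> powr (p - 1) \<le> A"
      using le A pos by (simp add: \<alpha> \<beta> ennreal_powr_ennreal flip: ennreal_mult)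
    then have "\<alpha> * \<beta> powr (p - 1) * m powr p \<le> A * m powr p" by (rule mult_right_mono) simp
    moreover have "m powr p = m * m powr (p - 1)" using m by (simp add: powr_mult_base)
    ultimately show "\<alpha> * m * (\<beta> * m) powr (p - 1) \<le> A * measure sphere_measure ?B powr p"
      using pos m unfolding m_def[symmetric] by (simp add: powr_mult mult_ac)
  qed (use pos m eq \<alpha> \<beta> in auto)
qed

text \<open>Hoelder's inequality on a single ball suffices; centre and radius are arbitrary. The
  bound allows powers of \<open>A\<close> to be compared by their exponents.\<close>

lemma Ap_norm_ge_1:
  fixes w :: "complex ^ 'n \<Rightarrow> real"
  assumes w: "weight w" and p: "1 < p" "1 / p + 1 / q = 1" and A: "Ap_norm p w = ennreal A" "0 \<le> A"
  shows "1 \<le> A"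
proof -
  interpret finite_measure "sphere_measure :: (complex ^ 'n) measure" by (rule finite_measure_sphere_measure)
  obtain k :: 'n where True by simp
  define u :: "complex ^ 'n" where "u = axis k 1"
  have u: "norm u = 1" by (simp add: u_def norm_eq_1 inner_axis_axis)
  let ?m = "measure sphere_measure (nonisotropic_ball u 1)"
  obtain a b where ab: "0 < a" "0 < b"
    "(\<integral>\<^sup>+ \<zeta> \<in> nonisotropic_ball u 1. ennreal (w \<zeta>) \<partial>sphere_measure) = ennreal a"
    "(\<integral>\<^sup>+ \<zeta> \<in> nonisotropic_ball u 1. ennreal (w \<zeta> powr (- (1 / (p - 1)))) \<partial>sphere_measure) = ennreal b"
    "a * b powr (p - 1) \<le> A * ?m powr p"
    using Ap_norm_ball[OF w p(1) A u, of 1] by auto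
  have "?m powr p \<le> a * b powr (p - 1)"
    using ab w by (intro Hoelder_dual_weights[OF p, of "nonisotropic_ball u 1" sphere_measure _ w])
      (auto simp: emeasure_eq_measure weight_def)
  with ab(5) have "1 * ?m powr p \<le> A * ?m powr p" by simp
  then show ?thesis using measure_nonisotropic_ball_pos[OF u, of 1] by simp
qed

section \<open>Comparison with Poisson averages\<close>

lemma kernel_denominator_ge:
  assumes "norm \<zeta> = 1" "norm z < 1"
  shows "1 - norm z \<le> cmod (1 - herm \<zeta> z)"
  using norm_triangle_ineq2[of 1 "herm \<zeta> z"] norm_herm_le[of \<zeta> z] assms by simp

lemma cmod_normalized_kernel:
  fixes z \<zeta> :: "complex ^ 'n"
  assumes "norm z < 1"
  shows "cmod (normalized_kernel z \<zeta>) = (1 - (norm z)\<^sup>2) powr (real CARD('n) / 2) / cmod (1 - herm \<zeta> z) ^ CARD('n)"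
  by (simp add: normalized_kernel_def norm_divide norm_power)

lemma normalized_kernel_pos:
  assumes "norm \<zeta> = 1" "norm z < 1"
  shows "0 < cmod (normalized_kernel z \<zeta>)"
proof -
  have "(norm z)\<^sup>2 < 1" using assms(2) by (simp add: power_less_one_iff abs_square_less_1)
  moreover have "0 < cmod (1 - herm \<zeta> z)" using kernel_denominator_ge[OF assms] assms(2) by linarith
  ultimately show ?thesis by (simp add: cmod_normalized_kernel[OF assms(2)])
qed

text \<open>The squared modulus in the Poisson kernel completes the exponent \<open>e - 2\<close> to
  \<open>e\<close>, since the kernel has no zero on the sphere.\<close>

lemma poisson_ext_kernel_powr:
  assumes "z \<in> ball 0 1"
  shows "poisson_ext (\<lambda>\<zeta>. v \<zeta> * cmod (normalized_kernel z \<zeta>) powr (e - 2)) z =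
    (\<integral>\<^sup>+ \<zeta>. ennreal (cmod (normalized_kernel z \<zeta>) powr e) * ennreal (v \<zeta>) \<partial>sphere_measure)"
  unfolding poisson_ext_def
proof (rule nn_integral_cong)
  fix \<zeta> assume "\<zeta> \<in> space (sphere_measure :: (complex ^ 'a) measure)"
  then have "0 < cmod (normalized_kernel z \<zeta>)" using assms by (intro normalized_kernel_pos) auto
  then have "cmod (normalized_kernel z \<zeta>) powr (e - 2) * (cmod (normalized_kernel z \<zeta>))\<^sup>2 = cmod (normalized_kernel z \<zeta>) powr e"
    by (simp add: powr_diff flip: powr_numeral)
  then have "v \<zeta> * cmod (normalized_kernel z \<zeta>) powr (e - 2) * (cmod (normalized_kernel z \<zeta>))\<^sup>2 =
      cmod (normalized_kernel z \<zeta>) powr e * v \<zeta>"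
    by (simp add: mult.assoc mult.commute)
  then show "ennreal (v \<zeta> * cmod (normalized_kernel z \<zeta>) powr (e - 2) * (cmod (normalized_kernel z \<zeta>))\<^sup>2) =
      ennreal (cmod (normalized_kernel z \<zeta>) powr e) * ennreal (v \<zeta>)"
    by (simp only: ennreal_mult'[OF powr_ge_zero])
qed

text \<open>The numerator is at least \<open>r ^ CARD('n)\<close>, because one minus the squared
  norm of the point is at least \<open>r\<^sup>2\<close>; the denominator is at most
  \<open>(2 * r\<^sup>2) ^ CARD('n)\<close>.\<close>

lemma normalized_kernel_ge:
  fixes u :: "complex ^ 'n"
  assumes u: "norm u = 1" and r: "0 < r" "r \<le> 1" and \<zeta>: "norm \<zeta> = 1"
    and le: "cmod (1 - herm \<zeta> ((1 - r\<^sup>2) *\<^sub>R u)) \<le> 2 * r\<^sup>2"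
  shows "1 / (2 * r) ^ CARD('n) \<le> cmod (normalized_kernel ((1 - r\<^sup>2) *\<^sub>R u) \<zeta>)"
proof -
  let ?n = "CARD('n)" and ?z = "(1 - r\<^sup>2) *\<^sub>R u"
  have r2: "0 < r\<^sup>2" "r\<^sup>2 \<le> 1" using r by (simp_all add: power_le_one)
  have nz: "norm ?z = 1 - r\<^sup>2" using u r2 by simp
  have z1: "norm ?z < 1" unfolding nz using r2 by simp
  have "0 < cmod (1 - herm \<zeta> ?z)" using kernel_denominator_ge[OF \<zeta> z1] z1 by linarith
  have "r\<^sup>2 \<le> 1 - (norm ?z)\<^sup>2"
  proof -
    have "r\<^sup>2 * r\<^sup>2 \<le> r\<^sup>2 * 1" using r2 by (intro mult_left_mono) auto
    then show ?thesis unfolding nz by (simp add: power2_eq_square algebra_simps)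
  qed
  then have "(r\<^sup>2) powr (real ?n / 2) \<le> (1 - (norm ?z)\<^sup>2) powr (real ?n / 2)"
    using r2 by (intro powr_mono2) auto
  moreover have "(r\<^sup>2) powr (real ?n / 2) = r ^ ?n"
    using r by (simp add: powr_powr powr_realpow flip: powr_numeral)
  moreover have "cmod (1 - herm \<zeta> ?z) ^ ?n \<le> (2 * r\<^sup>2) ^ ?n"
    using le by (intro power_mono) auto
  ultimately have "r ^ ?n / (2 * r\<^sup>2) ^ ?n \<le> cmod (normalized_kernel ?z \<zeta>)"
    unfolding cmod_normalized_kernel[OF z1] using r \<open>0 < cmod (1 - herm \<zeta> ?z)\<close>
    by (intro frac_le) auto
  moreover have "r ^ ?n / (2 * r\<^sup>2) ^ ?n = 1 / (2 * r) ^ ?n"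
    using r by (simp add: power2_eq_square power_mult_distrib)
  ultimately show ?thesis by simp
qed

text \<open>For \<open>r \<le> 1\<close>, moving from \<open>u\<close> to the interior point changes
  \<open>1 - herm \<zeta> u\<close> by at most \<open>\<rho>\<^sup>2\<close>, so
  \<open>normalized_kernel_ge\<close> bounds the kernel from below on the whole ball. For
  \<open>r > 1\<close> the point is the origin, where the kernel is constantly 1.\<close>

lemma average_le_poisson_ext:
  fixes u :: "complex ^ 'n"
  assumes v: "v \<in> borel_measurable sphere_measure" and u: "norm u = 1" and r: "0 < r" and e: "0 < e"
    and \<rho>: "\<rho> = min r 1"
    and c: "0 < c" "c * \<rho> ^ (2 * CARD('n)) \<le> measure sphere_measure (nonisotropic_ball u r)"
  shows "average (nonisotropic_ball u r) v \<le>
    ennreal (((2 * \<rho>) ^ CARD('n)) powr e / (c * \<rho> ^ (2 * CARD('n)))) *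
    poisson_ext (\<lambda>\<zeta>. v \<zeta> * cmod (normalized_kernel ((1 - \<rho>\<^sup>2) *\<^sub>R u) \<zeta>) powr (e - 2)) ((1 - \<rho>\<^sup>2) *\<^sub>R u)"
proof -
  interpret finite_measure "sphere_measure :: (complex ^ 'n) measure" by (rule finite_measure_sphere_measure)
  let ?B = "nonisotropic_ball u r" and ?z = "(1 - \<rho>\<^sup>2) *\<^sub>R u"
  let ?P = "poisson_ext (\<lambda>\<zeta>. v \<zeta> * cmod (normalized_kernel ?z \<zeta>) powr (e - 2)) ?z"
  have \<rho>1: "0 < \<rho>" "\<rho> \<le> 1" using r by (auto simp: \<rho>)
  define g where "g = ((2 * \<rho>) ^ CARD('n)) powr e"
  define m where "m = c * \<rho> ^ (2 * CARD('n))"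
  have g: "0 < g" and m: "0 < m" using \<rho>1 c by (simp_all add: g_def m_def)
  have \<rho>2: "0 < \<rho>\<^sup>2" "\<rho>\<^sup>2 \<le> 1" using \<rho>1 by (simp_all add: power_le_one)
  have z: "?z \<in> ball 0 1" using u \<rho>2 by simp
  have ker: "1 / g \<le> cmod (normalized_kernel ?z \<zeta>) powr e" if "\<zeta> \<in> ?B" for \<zeta>
  proof -
    have \<zeta>: "norm \<zeta> = 1" "cmod (1 - herm \<zeta> u) < r\<^sup>2" using that nonisotropic_ball_iff[OF r] by auto
    have "cmod (1 - herm \<zeta> ?z) \<le> 2 * \<rho>\<^sup>2"
    proof (cases "r \<le> 1")
      case True
      then have [simp]: "\<rho> = r" by (simp add: \<rho>)
      have "1 - herm \<zeta> ?z = (1 - herm \<zeta> u) + r\<^sup>2 * herm \<zeta> u"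
        by (simp add: herm_scaleR_right left_diff_distrib)
      then have "cmod (1 - herm \<zeta> ?z) \<le> cmod (1 - herm \<zeta> u) + cmod (r\<^sup>2 * herm \<zeta> u)"
        by (metis norm_triangle_ineq)
      moreover have "cmod (r\<^sup>2 * herm \<zeta> u) \<le> r\<^sup>2 * 1"
        unfolding norm_mult using norm_herm_le[of \<zeta> u] \<zeta> u by (intro mult_mono) (auto simp: norm_power)
      ultimately show ?thesis using \<zeta>(2) by simp
    next
      case False
      then have "\<rho> = 1" by (simp add: \<rho>)
      then show ?thesis by (simp add: herm_def)
    qed
    then have "1 / (2 * \<rho>) ^ CARD('n) \<le> cmod (normalized_kernel ?z \<zeta>)"
      by (intro normalized_kernel_ge u \<rho>1 \<zeta>)
    then have "(1 / (2 * \<rho>) ^ CARD('n)) powr e \<le> cmod (normalized_kernel ?z \<zeta>) powr e"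
      using e \<rho>1 by (intro powr_mono2) auto
    then show ?thesis using \<rho>1 by (simp add: g_def powr_divide)
  qed
  have "ennreal (1 / g) * (\<integral>\<^sup>+ \<zeta> \<in> ?B. ennreal (v \<zeta>) \<partial>sphere_measure) =
      (\<integral>\<^sup>+ \<zeta>. ennreal (1 / g) * (ennreal (v \<zeta>) * indicator ?B \<zeta>) \<partial>sphere_measure)"
    by (intro nn_integral_cmult[symmetric] borel_measurable_times_ennreal borel_measurable_indicator
      nonisotropic_ball_sets measurable_compose[OF v measurable_ennreal])
  also have "\<dots> \<le> ?P"
    unfolding poisson_ext_kernel_powr[OF z]
    using ker by (intro nn_integral_mono) (auto split: split_indicator intro!: mult_right_mono ennreal_leI)
  finally have "ennreal g * (ennreal (1 / g) * (\<integral>\<^sup>+ \<zeta> \<in> ?B. ennreal (v \<zeta>) \<partial>sphere_measure)) \<le> ennreal g * ?P"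
    by (rule mult_left_mono) simp
  then have "(\<integral>\<^sup>+ \<zeta> \<in> ?B. ennreal (v \<zeta>) \<partial>sphere_measure) \<le> ennreal g * ?P"
    using g by (simp add: mult.assoc[symmetric] flip: ennreal_mult)
  moreover have "inverse (emeasure sphere_measure ?B) \<le> ennreal (1 / m)"
    using le_imp_inverse_le[OF c(2)[folded m_def] m] c(2)[folded m_def] m
    by (simp add: emeasure_eq_measure inverse_ennreal ennreal_leI inverse_eq_divide)
  ultimately have "average ?B v \<le> (ennreal g * ?P) * ennreal (1 / m)"
    unfolding average_def divide_ennreal_def by (rule mult_mono) auto
  also have "\<dots> = ennreal (g * (1 / m)) * ?P"
    using g m by (simp only: ennreal_mult'[OF less_imp_le] mult_ac)
  also have "g * (1 / m) = g / m" by simp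
  finally show ?thesis unfolding g_def m_def .
qed

text \<open>Each ball is tested against one interior point in the direction of its centre;
  \<open>average_le_poisson_ext\<close> is used for \<open>w\<close> with exponent \<open>p\<close>
  and for the dual weight with exponent \<open>q\<close>.\<close>

lemma Ap_norm_le_Ap_Poi_norm:
  fixes p q :: real
  assumes p: "1 < p" "1 / p + 1 / q = 1"
  obtains L where "0 < L" "\<And>w :: complex ^ 'n \<Rightarrow> real. weight w \<Longrightarrow> Ap_norm p w \<le> ennreal L * Ap_Poi_norm p q w"
proof -
  interpret finite_measure "sphere_measure :: (complex ^ 'n) measure" by (rule finite_measure_sphere_measure)
  obtain c C where c: "0 < c"
    "\<And>(u :: complex ^ 'n) r. norm u = 1 \<Longrightarrow> 0 < r \<Longrightarrow> r \<le> 2 \<Longrightarrow>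
       c * r ^ (2 * CARD('n)) \<le> measure sphere_measure (nonisotropic_ball u r) \<and>
       measure sphere_measure (nonisotropic_ball u r) \<le> C * r ^ (2 * CARD('n))"
    using measure_nonisotropic_ball[where 'n='n] by metis
  have q: "0 < q" "q * (p - 1) = p" using conjugate_exponents[OF p] by simp_all
  define L where "L = (4 ^ CARD('n) / c) powr p"
  show thesis
  proof (rule that[of L])
    show "0 < L" using c by (simp add: L_def)
  next
    fix w :: "complex ^ 'n \<Rightarrow> real" assume w: "weight w"
    then have wm: "w \<in> borel_measurable sphere_measure" by (simp add: weight_def)
    show "Ap_norm p w \<le> ennreal L * Ap_Poi_norm p q w"
      unfolding Ap_norm_def
    proof (rule SUP_least)
      fix B assume "B \<in> {nonisotropic_ball u r |u r. (u :: complex ^ 'n) \<in> sphere 0 1 \<and> 0 < r}"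
      then obtain u :: "complex ^ 'n" and r where B: "B = nonisotropic_ball u r" and u: "norm u = 1" and r: "0 < r"
        by auto
      define \<rho> where "\<rho> = min r 1"
      define z where "z = (1 - \<rho>\<^sup>2) *\<^sub>R u"
      have \<rho>: "0 < \<rho>" "\<rho> \<le> 1" "\<rho> \<le> r" using r by (auto simp: \<rho>_def)
      have "\<rho>\<^sup>2 \<le> 1" "0 < \<rho>\<^sup>2" using \<rho> by (simp_all add: power_le_one)
      then have z: "z \<in> ball 0 1" using u by (simp add: z_def)
      have "c * \<rho> ^ (2 * CARD('n)) \<le> measure sphere_measure (nonisotropic_ball u \<rho>)"
        using c(2)[OF u, of \<rho>] \<rho> by simp
      also have "\<dots> \<le> measure sphere_measure B"
        unfolding B by (intro finite_measure_mono nonisotropic_ball_mono \<rho> nonisotropic_ball_sets)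
      finally have m: "c * \<rho> ^ (2 * CARD('n)) \<le> measure sphere_measure B" .
      let ?l = "\<lambda>e. ((2 * \<rho>) ^ CARD('n)) powr e / (c * \<rho> ^ (2 * CARD('n)))"
      let ?X = "poisson_ext (\<lambda>\<zeta>. w \<zeta> * cmod (normalized_kernel z \<zeta>) powr (p - 2)) z"
      let ?v = "\<lambda>\<zeta>. w \<zeta> powr (- (1 / (p - 1)))"
      let ?Y = "poisson_ext (\<lambda>\<zeta>. ?v \<zeta> * cmod (normalized_kernel z \<zeta>) powr (q - 2)) z"
      have "average B w \<le> ennreal (?l p) * ?X"
        unfolding B z_def using m p unfolding B
        by (intro average_le_poisson_ext wm u r \<rho>_def c) auto
      moreover have "average B ?v \<le> ennreal (?l q) * ?Y"
        unfolding B z_def using m q wm unfolding B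
        by (intro average_le_poisson_ext u r \<rho>_def c) auto
      then have "ennreal_powr (average B ?v) (p - 1) \<le> ennreal_powr (ennreal (?l q) * ?Y) (p - 1)"
        using p by (intro ennreal_powr_mono) auto
      ultimately have "average B w * ennreal_powr (average B ?v) (p - 1) \<le>
          (ennreal (?l p) * ?X) * ennreal_powr (ennreal (?l q) * ?Y) (p - 1)"
        by (rule mult_mono) auto
      also have "\<dots> = ennreal (?l p * ?l q powr (p - 1)) * (?X * ennreal_powr ?Y (p - 1))"
      proof -
        have "0 < ?l p" "0 < ?l q" using \<rho> c by simp_all
        then show ?thesis
          by (simp only: ennreal_powr_mult ennreal_mult'[OF less_imp_le] mult_ac)
      qed
      \<comment> \<open>As \<open>q * (p - 1) = p\<close>, the product is
        \<open>(t * t / s) powr p\<close> with \<open>t\<close> and \<open>s\<close> as below. Both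
        \<open>t * t\<close> and \<open>s\<close> scale like \<open>\<rho> ^ (2 * CARD('n))\<close>,
        so the radius drops out.\<close>
      also have "?l p * ?l q powr (p - 1) = L"
      proof -
        define t where "t = (2 * \<rho>) ^ CARD('n)"
        define s where "s = c * \<rho> ^ (2 * CARD('n))"
        have ts: "0 < t" "0 < s" using \<rho> c by (simp_all add: t_def s_def)
        have "t powr p / s * (t powr q / s) powr (p - 1) = t powr p * t powr p / (s * s powr (p - 1))"
          using ts by (simp add: powr_divide powr_powr q)
        also have "s * s powr (p - 1) = s powr p" using ts by (simp add: powr_mult_base)
        also have "t powr p * t powr p / s powr p = (t * t / s) powr p"
          using ts by (simp add: powr_mult powr_divide)
        also have "t * t / s = 4 ^ CARD('n) / c"
        proof -
          have "t * t = ((2 * \<rho>) * (2 * \<rho>)) ^ CARD('n)" by (simp only: t_def power_mult_distrib)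
          also have "(2 * \<rho>) * (2 * \<rho>) = 4 * \<rho>\<^sup>2" by (simp add: power2_eq_square)
          also have "(4 * \<rho>\<^sup>2) ^ CARD('n) = 4 ^ CARD('n) * \<rho> ^ (2 * CARD('n))"
            by (simp only: power_mult_distrib power_mult)
          finally show ?thesis using \<rho> by (simp add: s_def)
        qed
        finally show ?thesis unfolding L_def t_def s_def .
      qed
      also have "?X * ennreal_powr ?Y (p - 1) \<le> Ap_Poi_norm p q w"
        unfolding Ap_Poi_norm_def by (rule SUP_upper[OF z])
      finally show "average B w * ennreal_powr (average B ?v) (p - 1) \<le> ennreal L * Ap_Poi_norm p q w"
        by (simp add: mult_left_mono)
    qed
  qed
qed

section \<open>Upper estimate: annuli, reverse doubling and summation\<close>

lemma dyadic_annulus: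
  fixes u :: "complex ^ 'n" and M :: real
  assumes u: "norm u = 1" and z: "z = norm z *\<^sub>R u" "norm z < 1"
    and M: "1 < M" and N: "1 / M ^ (2 * Suc N) \<le> 1 - norm z" and \<zeta>: "norm \<zeta> = 1"
  obtains k where "k \<le> N" "\<zeta> \<in> nonisotropic_ball u (2 / M ^ k)" "1 / M ^ (2 * Suc k) \<le> cmod (1 - herm \<zeta> z)"
proof -
  \<comment> \<open>The index sought is the largest element of \<open>S\<close>; 0 belongs to
    \<open>S\<close> since the ball of radius 2 is the whole sphere. At \<open>k = N\<close> the
    bound comes from \<open>1 - norm z\<close>, otherwise from \<open>\<zeta>\<close> lying outside
    the next ball.\<close>
  define S where "S = {k. k \<le> N \<and> \<zeta> \<in> nonisotropic_ball u (2 / M ^ k)}"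
  have "finite S" by (simp add: S_def)
  moreover have "0 \<in> S" using nonisotropic_ball_eq_sphere[OF u, of 2] \<zeta> by (simp add: S_def)
  ultimately have k: "Max S \<in> S" and max: "\<And>j. j \<in> S \<Longrightarrow> j \<le> Max S" by (auto intro: Max_in)
  define k where "k = Max S"
  have kS: "k \<le> N" "\<zeta> \<in> nonisotropic_ball u (2 / M ^ k)" using k by (auto simp: S_def k_def)
  have den: "1 - norm z \<le> cmod (1 - herm \<zeta> z)" by (rule kernel_denominator_ge[OF \<zeta> z(2)])
  have "1 / M ^ (2 * Suc k) \<le> cmod (1 - herm \<zeta> z)"
  proof (cases "k = N")
    case True
    then show ?thesis using N den by simp
  next
    case False
    then have "Suc k \<notin> S" using max[of "Suc k"] by (auto simp: k_def)
    then have "\<zeta> \<notin> nonisotropic_ball u (2 / M ^ Suc k)" using False kS by (simp add: S_def)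
    moreover have "0 < 2 / M ^ Suc k" using M by simp
    ultimately have "(2 / M ^ Suc k)\<^sup>2 \<le> cmod (1 - herm \<zeta> u)"
      using nonisotropic_ball_iff[of "2 / M ^ Suc k" \<zeta> u] \<zeta> by simp
    \<comment> \<open>Replacing \<open>z\<close> by \<open>u\<close> costs at most
      \<open>1 - norm z\<close>, which is itself at most
      \<open>cmod (1 - herm \<zeta> z)\<close>.\<close>
    moreover have "cmod (1 - herm \<zeta> u) \<le> 2 * cmod (1 - herm \<zeta> z)"
    proof -
      have "herm \<zeta> z = norm z * herm \<zeta> u" by (subst z(1)) (rule herm_scaleR_right)
      then have "1 - herm \<zeta> u = (1 - herm \<zeta> z) - complex_of_real (1 - norm z) * herm \<zeta> u"
        by (simp add: algebra_simps)
      then have "cmod (1 - herm \<zeta> u) \<le> cmod (1 - herm \<zeta> z) + cmod (complex_of_real (1 - norm z) * herm \<zeta> u)"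
        by (metis norm_triangle_ineq4)
      moreover have "cmod (complex_of_real (1 - norm z) * herm \<zeta> u) \<le> (1 - norm z) * 1"
        unfolding norm_mult norm_of_real using norm_herm_le[of \<zeta> u] u \<zeta> z(2) by (intro mult_mono) auto
      ultimately show ?thesis using den by simp
    qed
    moreover have "1 / M ^ (2 * Suc k) \<le> 1 / 2 * (2 / M ^ Suc k)\<^sup>2"
    proof -
      have "(M ^ Suc k)\<^sup>2 = M ^ (2 * Suc k)" by (simp only: power_mult[symmetric] mult.commute)
      then have "(2 / M ^ Suc k)\<^sup>2 = 4 / M ^ (2 * Suc k)" by (simp only: power_divide) simp
      then show ?thesis using M by (simp add: divide_right_mono)
    qed
    ultimately show ?thesis by linarith
  qed
  with kS show thesis by (rule that)
qed

text \<open>At each \<open>\<zeta>\<close> the index from \<open>dyadic_annulus\<close> bounds the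
  kernel, and the sum over all \<open>k\<close> dominates the corresponding term. The first factor
  comes from \<open>1 - (norm z)\<^sup>2 \<le> 2 * (1 - norm z)\<close>; the exponent
  \<open>Suc k\<close> is the scale just inside the \<open>k\<close>-th ball.\<close>

lemma poisson_ext_le_sum:
  fixes u :: "complex ^ 'n" and M :: real
  assumes u: "norm u = 1" and z: "z = norm z *\<^sub>R u" "norm z < 1"
    and M: "1 < M" and N: "1 / M ^ (2 * Suc N) \<le> 1 - norm z" "1 - norm z \<le> 1 / M ^ (2 * N)"
    and v: "v \<in> borel_measurable sphere_measure" and e: "0 < e"
  shows "poisson_ext (\<lambda>\<zeta>. v \<zeta> * cmod (normalized_kernel z \<zeta>) powr (e - 2)) z \<le>
    (\<Sum>k\<le>N. ennreal (((2 / M ^ (2 * N)) powr (real CARD('n) / 2) * (M ^ (2 * CARD('n))) ^ Suc k) powr e) *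
      (\<integral>\<^sup>+ \<zeta> \<in> nonisotropic_ball u (2 / M ^ k). ennreal (v \<zeta>) \<partial>sphere_measure))"
proof -
  let ?B = "\<lambda>k. nonisotropic_ball u (2 / M ^ k)"
  define H where "H k = (2 / M ^ (2 * N)) powr (real CARD('n) / 2) * (M ^ (2 * CARD('n))) ^ Suc k" for k
  have zb: "z \<in> ball 0 1" using z by simp
  have meas: "(\<lambda>\<zeta>. ennreal (v \<zeta>) * indicator (?B k) \<zeta>) \<in> borel_measurable sphere_measure" for k
    by (intro borel_measurable_times_ennreal borel_measurable_indicator
      nonisotropic_ball_sets measurable_compose[OF v measurable_ennreal])
  have "poisson_ext (\<lambda>\<zeta>. v \<zeta> * cmod (normalized_kernel z \<zeta>) powr (e - 2)) z \<le>
      (\<integral>\<^sup>+ \<zeta>. (\<Sum>k\<le>N. ennreal (H k powr e) * (ennreal (v \<zeta>) * indicator (?B k) \<zeta>)) \<partial>sphere_measure)"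
    unfolding poisson_ext_kernel_powr[OF zb]
  proof (rule nn_integral_mono)
    fix \<zeta> assume "\<zeta> \<in> space (sphere_measure :: (complex ^ 'n) measure)"
    then have \<zeta>: "norm \<zeta> = 1" by simp
    obtain k where k: "k \<le> N" "\<zeta> \<in> ?B k" "1 / M ^ (2 * Suc k) \<le> cmod (1 - herm \<zeta> z)"
      using dyadic_annulus[OF u z M N(1) \<zeta>] by blast
    have "1 - (norm z)\<^sup>2 = (1 - norm z) * (1 + norm z)" by (simp add: power2_eq_square algebra_simps)
    also have "\<dots> \<le> 1 / M ^ (2 * N) * 2" using N z M by (intro mult_mono) auto
    finally have "(1 - (norm z)\<^sup>2) powr (real CARD('n) / 2) \<le> (2 / M ^ (2 * N)) powr (real CARD('n) / 2)"
      using z by (intro powr_mono2) (auto simp: power_le_one)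
    moreover have "(1 / M ^ (2 * Suc k)) ^ CARD('n) \<le> cmod (1 - herm \<zeta> z) ^ CARD('n)"
      using k M by (intro power_mono) auto
    ultimately have "cmod (normalized_kernel z \<zeta>) \<le>
        (2 / M ^ (2 * N)) powr (real CARD('n) / 2) / (1 / M ^ (2 * Suc k)) ^ CARD('n)"
      unfolding cmod_normalized_kernel[OF z(2)] using M by (intro frac_le) auto
    also have "(1 / M ^ (2 * Suc k)) ^ CARD('n) = 1 / (M ^ (2 * CARD('n))) ^ Suc k"
      by (simp only: power_one_over power_mult[symmetric] mult_ac)
    finally have "cmod (normalized_kernel z \<zeta>) \<le> H k" by (simp add: H_def)
    then have "cmod (normalized_kernel z \<zeta>) powr e \<le> H k powr e" using e by (intro powr_mono2) auto
    then have "ennreal (cmod (normalized_kernel z \<zeta>) powr e) * ennreal (v \<zeta>) \<le>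
        ennreal (H k powr e) * (ennreal (v \<zeta>) * indicator (?B k) \<zeta>)"
      using k(2) by (auto intro!: mult_right_mono ennreal_leI)
    also have "\<dots> \<le> (\<Sum>k\<le>N. ennreal (H k powr e) * (ennreal (v \<zeta>) * indicator (?B k) \<zeta>))"
      using k(1) by (intro member_le_sum[where f="\<lambda>k. ennreal (H k powr e) * (ennreal (v \<zeta>) * indicator (?B k) \<zeta>)"]) auto
    finally show "ennreal (cmod (normalized_kernel z \<zeta>) powr e) * ennreal (v \<zeta>) \<le>
        (\<Sum>k\<le>N. ennreal (H k powr e) * (ennreal (v \<zeta>) * indicator (?B k) \<zeta>))" .
  qed
  also have "\<dots> = (\<Sum>k\<le>N. ennreal (H k powr e) * (\<integral>\<^sup>+ \<zeta> \<in> ?B k. ennreal (v \<zeta>) \<partial>sphere_measure))"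
    by (subst nn_integral_sum)
       (intro borel_measurable_times_ennreal[OF borel_measurable_const meas], intro sum.cong refl nn_integral_cmult meas)
  finally show ?thesis unfolding H_def .
qed

text \<open>Hoelder's inequality on the annulus between the two balls: at least half of the larger ball
  lies there, so it carries a fixed proportion of both weights.\<close>
lemma Ap_reverse_doubling:
  fixes w :: "complex ^ 'n \<Rightarrow> real" and p q :: real
  assumes p: "1 < p" "1 / p + 1 / q = 1" and w: "weight w" and A: "1 \<le> A"
    and B: "measure sphere_measure (nonisotropic_ball u s) \<le> measure sphere_measure (nonisotropic_ball u r) / 2"
    and sr: "s \<le> r"
    and a: "(\<integral>\<^sup>+ \<zeta> \<in> nonisotropic_ball u r. ennreal (w \<zeta>) \<partial>sphere_measure) = ennreal a" "0 < a"
    and a': "(\<integral>\<^sup>+ \<zeta> \<in> nonisotropic_ball u s. ennreal (w \<zeta>) \<partial>sphere_measure) = ennreal a'" "0 < a'"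
    and b: "(\<integral>\<^sup>+ \<zeta> \<in> nonisotropic_ball u r. ennreal (w \<zeta> powr (- (1 / (p - 1)))) \<partial>sphere_measure) = ennreal b" "0 < b"
    and b': "(\<integral>\<^sup>+ \<zeta> \<in> nonisotropic_ball u s. ennreal (w \<zeta> powr (- (1 / (p - 1)))) \<partial>sphere_measure) = ennreal b'" "0 < b'"
    and ab: "a * b powr (p - 1) \<le> A * measure sphere_measure (nonisotropic_ball u r) powr p"
  shows "a' \<le> (1 - 2 powr (- p) / A) * a" and "b' \<le> (1 - 2 powr (- q) / A powr (q - 1)) * b"
proof -
  interpret finite_measure "sphere_measure :: (complex ^ 'n) measure" by (rule finite_measure_sphere_measure)
  let ?B = "nonisotropic_ball u r" and ?S = "nonisotropic_ball u s"
  let ?v = "\<lambda>\<zeta>. w \<zeta> powr (- (1 / (p - 1)))"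
  have sub: "?S \<subseteq> ?B" by (rule nonisotropic_ball_mono[OF sr])
  define m where "m = measure sphere_measure ?B"
  define m' where "m' = measure sphere_measure (?B - ?S)"
  have mm: "m / 2 \<le> m'" using B sub unfolding m'_def m_def by (simp add: finite_measure_Diff)
  have diff: "(\<integral>\<^sup>+ \<zeta> \<in> ?B - ?S. ennreal (h \<zeta>) \<partial>sphere_measure) = ennreal (x - x') \<and> 0 \<le> x - x'"
    if h: "h \<in> borel_measurable sphere_measure"
      and x: "(\<integral>\<^sup>+ \<zeta> \<in> ?B. ennreal (h \<zeta>) \<partial>sphere_measure) = ennreal x" "0 < x"
      and x': "(\<integral>\<^sup>+ \<zeta> \<in> ?S. ennreal (h \<zeta>) \<partial>sphere_measure) = ennreal x'" "0 < x'" for h x x'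
  proof -
    have meas: "(\<lambda>\<zeta>. ennreal (h \<zeta>) * indicator E \<zeta>) \<in> borel_measurable sphere_measure"
      if "E \<in> sets sphere_measure" for E
      by (intro borel_measurable_times_ennreal borel_measurable_indicator that measurable_compose[OF h measurable_ennreal])
    have "ennreal x = (\<integral>\<^sup>+ \<zeta>. ennreal (h \<zeta>) * indicator ?S \<zeta> + ennreal (h \<zeta>) * indicator (?B - ?S) \<zeta> \<partial>sphere_measure)"
      unfolding x(1)[symmetric] using sub by (intro nn_integral_cong) (auto split: split_indicator)
    also have "\<dots> = ennreal x' + (\<integral>\<^sup>+ \<zeta> \<in> ?B - ?S. ennreal (h \<zeta>) \<partial>sphere_measure)"
      unfolding x'(1)[symmetric]
      by (intro nn_integral_add meas sets.Diff nonisotropic_ball_sets)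
    finally have eq: "ennreal x = ennreal x' + (\<integral>\<^sup>+ \<zeta> \<in> ?B - ?S. ennreal (h \<zeta>) \<partial>sphere_measure)" .
    then obtain y where y: "(\<integral>\<^sup>+ \<zeta> \<in> ?B - ?S. ennreal (h \<zeta>) \<partial>sphere_measure) = ennreal y" "0 \<le> y"
      by (cases "\<integral>\<^sup>+ \<zeta> \<in> ?B - ?S. ennreal (h \<zeta>) \<partial>sphere_measure") auto
    then have "ennreal x = ennreal (x' + y)" using eq x'(2) by (simp add: ennreal_plus)
    then have "x = x' + y" using x(2) x'(2) y(2) by (subst (asm) ennreal_inj) auto
    then show ?thesis using y by simp
  qed
  have wm: "w \<in> borel_measurable sphere_measure" using w by (simp add: weight_def)
  have vm: "?v \<in> borel_measurable sphere_measure" using wm by measurable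
  note da = diff[OF wm a a'] and db = diff[OF vm b b']
  have "m' powr p \<le> (a - a') * (b - b') powr (p - 1)"
    using w da db
    by (intro Hoelder_dual_weights[OF p, of "?B - ?S" sphere_measure _ w])
       (auto simp: weight_def m'_def emeasure_eq_measure)
  moreover have "(m / 2) powr p \<le> m' powr p" using mm p by (intro powr_mono2) (auto simp: m_def)
  ultimately have "(m / 2) powr p \<le> (a - a') * (b - b') powr (p - 1)" by linarith
  then have "A * 2 powr p * (m / 2) powr p \<le> A * 2 powr p * ((a - a') * (b - b') powr (p - 1))"
    using A by (intro mult_left_mono) auto
  moreover have "A * 2 powr p * (m / 2) powr p = A * m powr p" by (simp add: powr_divide m_def)
  \<comment> \<open>The annulus has at least half the measure of the ball, so up to
    \<open>A * 2 powr p\<close> its two masses already control those of the whole ball.\<close>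
  ultimately have main: "a * b powr (p - 1) \<le> A * 2 powr p * ((a - a') * (b - b') powr (p - 1))"
    using ab unfolding m_def[symmetric] by linarith
  have p0: "0 < A * 2 powr p" using A by simp
  \<comment> \<open>Enlarging \<open>b - b'\<close> to \<open>b\<close> lets the dual mass cancel,
    leaving a lower bound for \<open>a - a'\<close>.\<close>
  have "(b - b') powr (p - 1) \<le> b powr (p - 1)" using db b' p by (intro powr_mono2) auto
  then have "A * 2 powr p * ((a - a') * (b - b') powr (p - 1)) \<le> A * 2 powr p * ((a - a') * b powr (p - 1))"
    using da p0 by (intro mult_left_mono) auto
  with main have "a * b powr (p - 1) \<le> (A * 2 powr p * (a - a')) * b powr (p - 1)" by (simp add: mult_ac)
  then have "a \<le> A * 2 powr p * (a - a')" using b by simp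
  then show "a' \<le> (1 - 2 powr (- p) / A) * a" using A by (simp add: powr_minus field_simps)
  have q: "0 < q - 1" "(p - 1) * (q - 1) = 1" "p * (q - 1) = q"
    using conjugate_exponents[OF p] by simp_all
  \<comment> \<open>Symmetrically, enlarging \<open>a - a'\<close> to \<open>a\<close> cancels the
    mass of \<open>w\<close>. Raising to the power \<open>q - 1\<close> removes the exponent
    \<open>p - 1\<close> and produces \<open>A powr (q - 1)\<close> and
    \<open>2 powr q\<close>.\<close>
  have "A * 2 powr p * ((a - a') * (b - b') powr (p - 1)) \<le> A * 2 powr p * (a * (b - b') powr (p - 1))"
    using a' p0 by (intro mult_left_mono mult_right_mono) auto
  with main have "a * b powr (p - 1) \<le> a * (A * 2 powr p * (b - b') powr (p - 1))" by (simp add: mult_ac)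
  then have "b powr (p - 1) \<le> A * 2 powr p * (b - b') powr (p - 1)" using a by simp
  then have "(b powr (p - 1)) powr (q - 1) \<le> (A * 2 powr p * (b - b') powr (p - 1)) powr (q - 1)"
    using q by (intro powr_mono2) auto
  then have "b \<le> A powr (q - 1) * 2 powr q * (b - b')"
    using A b db q by (simp add: powr_mult powr_powr)
  moreover have "0 < A powr (q - 1)" using A by simp
  ultimately show "b' \<le> (1 - 2 powr (- q) / A powr (q - 1)) * b" by (simp add: powr_minus field_simps)
qed

text \<open>The least power of \<open>M\<^sup>2\<close> exceeding \<open>1 / t\<close> has nonzero
  exponent because \<open>1 / t \<ge> 1\<close>; \<open>N\<close> is the predecessor of that
  exponent.\<close>

lemma ex_dyadic_scale:
  fixes M t :: real
  assumes "1 < M" "0 < t" "t \<le> 1"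
  obtains N where "1 / M ^ (2 * Suc N) \<le> t" "t \<le> 1 / M ^ (2 * N)"
proof -
  have M2: "1 < M\<^sup>2" using assms(1) by (simp add: one_less_power)
  obtain n where n: "1 / t < (M\<^sup>2) ^ n" using real_arch_pow[OF M2] by blast
  define m where "m = (LEAST n. 1 / t < (M\<^sup>2) ^ n)"
  have m: "1 / t < (M\<^sup>2) ^ m" unfolding m_def by (rule LeastI[of _ n]) (rule n)
  have "m \<noteq> 0" using m assms by (intro notI) (simp add: field_simps)
  then obtain N where N: "m = Suc N" by (metis not0_implies_Suc)
  have "\<not> 1 / t < (M\<^sup>2) ^ N" using not_less_Least[of N "\<lambda>n. 1 / t < (M\<^sup>2) ^ n"] N by (simp add: m_def)
  then have le: "M ^ (2 * N) \<le> 1 / t" by (simp add: power_mult)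
  have less: "1 / t < M ^ (2 * Suc N)" using m unfolding N by (simp only: power_mult)
  have pos: "0 < M ^ (2 * N)" "0 < M ^ (2 * Suc N)" using assms by simp_all
  show thesis
  proof (rule that)
    show "1 / M ^ (2 * Suc N) \<le> t"
      using less pos(2) assms(2) by (simp only: divide_le_eq pos_divide_less_eq if_True mult.commute less_imp_le)
    show "t \<le> 1 / M ^ (2 * N)"
      using le pos(1) assms(2) by (simp only: pos_le_divide_eq mult.commute)
  qed
qed

text \<open>The masses of the balls \<open>?B k\<close> satisfy the hypotheses of
  \<open>weighted_sums_product_le\<close>: the size estimate turns the bound on each ball into the
  diagonal condition, and reverse doubling gives the decay.\<close>

lemma Ap_Poi_norm_le_Ap_norm:
  fixes p q :: real
  assumes p: "1 < p" "1 / p + 1 / q = 1"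
  obtains C where "0 < C"
    "\<And>(w :: complex ^ 'n \<Rightarrow> real) A. weight w \<Longrightarrow> Ap_norm p w = ennreal A \<Longrightarrow> 0 \<le> A \<Longrightarrow>
       Ap_Poi_norm p q w \<le> ennreal (C * A powr max p q)"
proof -
  interpret finite_measure "sphere_measure :: (complex ^ 'n) measure" by (rule finite_measure_sphere_measure)
  obtain c C0 where c: "0 < c" "0 < C0"
    "\<And>(u :: complex ^ 'n) r. norm u = 1 \<Longrightarrow> 0 < r \<Longrightarrow> r \<le> 2 \<Longrightarrow>
       c * r ^ (2 * CARD('n)) \<le> measure sphere_measure (nonisotropic_ball u r) \<and>
       measure sphere_measure (nonisotropic_ball u r) \<le> C0 * r ^ (2 * CARD('n))"
    using measure_nonisotropic_ball[where 'n='n] by metis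
  have q: "0 < q" "q * (p - 1) = p" using conjugate_exponents[OF p] by simp_all
  \<comment> \<open>This ratio of radii is large enough for the upper size bound of one ball to be
    at most half the lower bound of the preceding one, as reverse doubling requires.\<close>
  define M where "M = max 2 (2 * C0 / c)"
  define D where "D = M ^ (2 * CARD('n))"
  \<comment> \<open>\<open>K / (D powr p) ^ k\<close> is the \<open>p\<close>-th power of the upper
    size bound for the \<open>k\<close>-th ball.\<close>
  define K where "K = (C0 * 4 ^ CARD('n)) powr p"
  have M: "2 \<le> M" "1 < M" "0 < M" "2 * C0 \<le> c * M"
    using c by (auto simp: M_def max_def field_simps)
  have MD: "M \<le> D" using M by (simp add: D_def self_le_power)
  then have D: "2 \<le> D" "0 < D" using M by auto
  have C0D: "2 * C0 \<le> c * D" using M(4) MD c by (meson mult_left_mono less_imp_le order_trans)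
  have scale: "(2 / M ^ k) ^ (2 * CARD('n)) = 4 ^ CARD('n) / D ^ k" for k
  proof -
    have "(M ^ k) ^ (2 * CARD('n)) = D ^ k" by (simp only: D_def power_mult[symmetric] mult.commute)
    moreover have "(2 :: real) ^ (2 * CARD('n)) = 4 ^ CARD('n)" by (simp add: power_mult)
    ultimately show ?thesis by (simp only: power_divide)
  qed
  have K: "0 < K" using c by (simp add: K_def)
  have "0 < (2 :: real) powr (- p)" "(2 :: real) powr (- p) < 1" "0 < (2 :: real) powr (- q)" "(2 :: real) powr (- q) < 1"
    using p q by (simp_all add: powr_less_one)
  from weighted_sums_product_le[OF p D(1) K this]
  obtain C1 where C1: "0 < C1"
    "\<And>A N W V. 1 \<le> A \<Longrightarrow>
      (\<And>k. k \<le> N \<Longrightarrow> 0 < W k) \<Longrightarrow> (\<And>k. k \<le> N \<Longrightarrow> 0 < V k) \<Longrightarrow>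
      (\<And>k. k \<le> N \<Longrightarrow> W k * V k powr (p - 1) \<le> A * K / (D powr p) ^ k) \<Longrightarrow>
      (\<And>k. k < N \<Longrightarrow> W (Suc k) \<le> (1 - 2 powr (- p) / A) * W k) \<Longrightarrow>
      (\<And>k. k < N \<Longrightarrow> V (Suc k) \<le> (1 - 2 powr (- q) / A powr (q - 1)) * V k) \<Longrightarrow>
      (\<Sum>k\<le>N. (D powr p) ^ k * W k) * (\<Sum>k\<le>N. (D powr q) ^ k * V k) powr (p - 1)
        \<le> C1 * A powr max p q * (D powr p) ^ N" by blast
  define C where "C = (2 ^ CARD('n) * D\<^sup>2) powr p * C1"
  show thesis
  proof (rule that[of C])
    show "0 < C" using C1 D by (simp add: C_def)
  next
    fix w :: "complex ^ 'n \<Rightarrow> real" and A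
    assume w: "weight w" and A: "Ap_norm p w = ennreal A" "0 \<le> A"
    have A1: "1 \<le> A" by (rule Ap_norm_ge_1[OF w p A])
    have wm: "w \<in> borel_measurable sphere_measure" using w by (simp add: weight_def)
    let ?v = "\<lambda>\<zeta>. w \<zeta> powr (- (1 / (p - 1)))"
    have vm: "?v \<in> borel_measurable sphere_measure" using wm by measurable
    show "Ap_Poi_norm p q w \<le> ennreal (C * A powr max p q)"
      unfolding Ap_Poi_norm_def
    proof (rule SUP_least)
      fix z :: "complex ^ 'n" assume "z \<in> ball 0 1"
      then have z1: "norm z < 1" by simp
      \<comment> \<open>At the origin any direction serves.\<close>
      obtain u where u: "norm u = 1" "z = norm z *\<^sub>R u"
      proof (cases "z = 0")
        case True
        obtain k :: 'n where True by simp
        show thesis by (rule that[of "axis k 1"]) (simp_all add: True norm_eq_1 inner_axis_axis)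
      next
        case False
        show thesis by (rule that[of "z /\<^sub>R norm z"]) (use False in simp_all)
      qed
      obtain N where N: "1 / M ^ (2 * Suc N) \<le> 1 - norm z" "1 - norm z \<le> 1 / M ^ (2 * N)"
        using ex_dyadic_scale[OF M(2), of "1 - norm z"] z1 by auto
      let ?B = "\<lambda>k. nonisotropic_ball u (2 / M ^ k)"
      define W where "W k = enn2real (\<integral>\<^sup>+ \<zeta> \<in> ?B k. ennreal (w \<zeta>) \<partial>sphere_measure)" for k
      define V where "V k = enn2real (\<integral>\<^sup>+ \<zeta> \<in> ?B k. ennreal (?v \<zeta>) \<partial>sphere_measure)" for k
      have WV: "0 < W k" "0 < V k"
        "(\<integral>\<^sup>+ \<zeta> \<in> ?B k. ennreal (w \<zeta>) \<partial>sphere_measure) = ennreal (W k)"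
        "(\<integral>\<^sup>+ \<zeta> \<in> ?B k. ennreal (?v \<zeta>) \<partial>sphere_measure) = ennreal (V k)"
        "W k * V k powr (p - 1) \<le> A * measure sphere_measure (?B k) powr p" for k
      proof -
        have "0 < 2 / M ^ k" using M by simp
        then obtain a b where ab: "0 < a" "0 < b"
          "(\<integral>\<^sup>+ \<zeta> \<in> ?B k. ennreal (w \<zeta>) \<partial>sphere_measure) = ennreal a"
          "(\<integral>\<^sup>+ \<zeta> \<in> ?B k. ennreal (?v \<zeta>) \<partial>sphere_measure) = ennreal b"
          "a * b powr (p - 1) \<le> A * measure sphere_measure (?B k) powr p"
          by (rule Ap_norm_ball[OF w p(1) A u(1)])
        have eq: "W k = a" "V k = b" unfolding W_def V_def ab using ab(1,2) by simp_all
        show "0 < W k" "0 < V k"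
          "(\<integral>\<^sup>+ \<zeta> \<in> ?B k. ennreal (w \<zeta>) \<partial>sphere_measure) = ennreal (W k)"
          "(\<integral>\<^sup>+ \<zeta> \<in> ?B k. ennreal (?v \<zeta>) \<partial>sphere_measure) = ennreal (V k)"
          "W k * V k powr (p - 1) \<le> A * measure sphere_measure (?B k) powr p"
          unfolding eq by (rule ab)+
      qed
      have size: "c * (4 ^ CARD('n) / D ^ k) \<le> measure sphere_measure (?B k)"
        "measure sphere_measure (?B k) \<le> C0 * (4 ^ CARD('n) / D ^ k)" for k
      proof -
        have "1 \<le> M ^ k" using M by simp
        then have "0 < 2 / M ^ k" "2 / M ^ k \<le> 2" using M by (simp_all add: divide_le_eq)
        from c(3)[OF u(1) this] show "c * (4 ^ CARD('n) / D ^ k) \<le> measure sphere_measure (?B k)"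
          "measure sphere_measure (?B k) \<le> C0 * (4 ^ CARD('n) / D ^ k)" unfolding scale by auto
      qed
      have half: "measure sphere_measure (?B (Suc k)) \<le> measure sphere_measure (?B k) / 2" for k
      proof -
        have "C0 * (4 ^ CARD('n) / D ^ Suc k) = (2 * C0 / D) * (4 ^ CARD('n) / D ^ k) / 2" by simp
        also have "\<dots> \<le> c * (4 ^ CARD('n) / D ^ k) / 2"
          using C0D D by (intro divide_right_mono mult_right_mono) (auto simp: divide_le_eq)
        also have "\<dots> \<le> measure sphere_measure (?B k) / 2"
          using size(1) by (rule divide_right_mono) simp
        finally show ?thesis using size(2) by (rule order_trans[rotated])
      qed
      have anti: "2 / M ^ Suc k \<le> 2 / M ^ k" for k
        using M by (intro divide_left_mono) (auto simp: mult_le_cancel_right1)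
      define S where "S = (\<Sum>k\<le>N. (D powr p) ^ k * W k)"
      define T where "T = (\<Sum>k\<le>N. (D powr q) ^ k * V k)"
      have S0: "0 \<le> S" and T0: "0 \<le> T"
        using WV(1,2) unfolding S_def T_def by (auto intro!: sum_nonneg simp: less_imp_le)
      have ST: "S * T powr (p - 1) \<le> C1 * A powr max p q * (D powr p) ^ N"
        unfolding S_def T_def
      proof (rule C1(2)[OF A1])
        fix k
        show "0 < W k" "0 < V k" by (rule WV)+
        have "A * measure sphere_measure (?B k) powr p \<le> A * (C0 * (4 ^ CARD('n) / D ^ k)) powr p"
          using size(2)[of k] A1 p by (intro mult_left_mono powr_mono2) auto
        also have "\<dots> = A * K / (D powr p) ^ k"
          using c D by (simp add: K_def powr_mult powr_divide power_powr_commute)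
        finally show "W k * V k powr (p - 1) \<le> A * K / (D powr p) ^ k" using WV(5)[of k] by linarith
        show "W (Suc k) \<le> (1 - 2 powr (- p) / A) * W k"
          by (rule Ap_reverse_doubling(1)[OF p w A1 half[of k] anti WV(3) WV(1) WV(3) WV(1) WV(4) WV(2) WV(4) WV(2) WV(5)])
        show "V (Suc k) \<le> (1 - 2 powr (- q) / A powr (q - 1)) * V k"
          by (rule Ap_reverse_doubling(2)[OF p w A1 half[of k] anti WV(3) WV(1) WV(3) WV(1) WV(4) WV(2) WV(4) WV(2) WV(5)])
      qed
      \<comment> \<open>\<open>h\<close> bounds the numerator of the kernel. The exponent
        \<open>Suc k\<close> supplies one factor \<open>D\<close> beyond \<open>D ^ k\<close>, which
        is absorbed into \<open>g\<close>.\<close>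
      define h where "h = (2 / M ^ (2 * N)) powr (real CARD('n) / 2)"
      define g where "g = h * D"
      have h0: "0 < h" using M by (simp add: h_def)
      then have g0: "0 < g" using D by (simp add: g_def)
      have sum_eq: "(\<Sum>k\<le>N. ennreal ((h * D ^ Suc k) powr e) * ennreal (f k)) =
          ennreal (g powr e * (\<Sum>k\<le>N. (D powr e) ^ k * f k))" if f: "\<And>k. 0 < f k" for e f
      proof -
        have "(h * D ^ Suc k) powr e = g powr e * (D powr e) ^ k" for k
        proof -
          have "h * D ^ Suc k = g * D ^ k" by (simp add: g_def)
          then show ?thesis using D by (simp only: powr_mult power_powr_commute)
        qed
        then have "(\<Sum>k\<le>N. ennreal ((h * D ^ Suc k) powr e) * ennreal (f k)) =
            (\<Sum>k\<le>N. ennreal (g powr e * ((D powr e) ^ k * f k)))"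
          using f by (intro sum.cong refl) (simp add: mult.assoc less_imp_le flip: ennreal_mult)
        also have "\<dots> = ennreal (\<Sum>k\<le>N. g powr e * ((D powr e) ^ k * f k))"
          using f D by (intro sum_ennreal) (auto simp: less_imp_le)
        finally show ?thesis by (simp only: sum_distrib_left)
      qed
      let ?X = "poisson_ext (\<lambda>\<zeta>. w \<zeta> * cmod (normalized_kernel z \<zeta>) powr (p - 2)) z"
      let ?Y = "poisson_ext (\<lambda>\<zeta>. ?v \<zeta> * cmod (normalized_kernel z \<zeta>) powr (q - 2)) z"
      have p0: "0 < p" using p by simp
      have X: "?X \<le> ennreal (g powr p * S)"
        using poisson_ext_le_sum[OF u(1) u(2) z1 M(2) N wm p0]
        unfolding WV(3) D_def[symmetric] h_def[symmetric] sum_eq[OF WV(1)] S_def .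
      have Y: "?Y \<le> ennreal (g powr q * T)"
        using poisson_ext_le_sum[OF u(1) u(2) z1 M(2) N vm q(1)]
        unfolding WV(4) D_def[symmetric] h_def[symmetric] sum_eq[OF WV(2)] T_def .
      have "?X * ennreal_powr ?Y (p - 1) \<le> ennreal (g powr p * S) * ennreal_powr (ennreal (g powr q * T)) (p - 1)"
        using X Y p by (intro mult_mono ennreal_powr_mono) auto
      also have "\<dots> = ennreal (g powr p * g powr p * (S * T powr (p - 1)))"
        using S0 T0 g0 by (simp add: ennreal_powr_ennreal powr_mult powr_powr q mult_ac flip: ennreal_mult)
      also have "\<dots> \<le> ennreal (g powr p * g powr p * (C1 * A powr max p q * (D powr p) ^ N))"
        using ST by (intro ennreal_leI mult_left_mono) auto
      \<comment> \<open>Both factors contribute \<open>g powr p\<close>, the second because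
        \<open>q * (p - 1) = p\<close>. Since \<open>g * g\<close> is a constant over
        \<open>D ^ N\<close>, this cancels \<open>(D powr p) ^ N\<close> and leaves a bound free of
        \<open>N\<close> and \<open>z\<close>.\<close>
      also have "g powr p * g powr p * (C1 * A powr max p q * (D powr p) ^ N) = C * A powr max p q"
      proof -
        have "h * h = (2 / M ^ (2 * N)) powr (real CARD('n))" by (simp add: h_def powr_add[symmetric])
        also have "\<dots> = (2 / M ^ (2 * N)) ^ CARD('n)" using M by (simp add: powr_realpow)
        also have "\<dots> = 2 ^ CARD('n) / D ^ N"
          by (simp only: power_divide D_def power_mult[symmetric] mult_ac)
        finally have "g * g = 2 ^ CARD('n) * D\<^sup>2 / D ^ N"
          by (simp add: g_def power2_eq_square mult_ac) 
        then have "g powr p * g powr p = (2 ^ CARD('n) * D\<^sup>2 / D ^ N) powr p"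
          using g0 by (simp add: powr_mult[symmetric])
        also have "\<dots> = (2 ^ CARD('n) * D\<^sup>2) powr p / (D powr p) ^ N"
          using D by (simp add: powr_divide power_powr_commute)
        finally show ?thesis using D by (simp add: C_def)
      qed
      finally show "?X * ennreal_powr ?Y (p - 1) \<le> ennreal (C * A powr max p q)" .
    qed
  qed
qed

theorem proposition4p4:
  fixes p q :: real
  assumes "1 < p" and "1 / p + 1 / q = 1"
  shows "(\<forall>w :: complex ^ 'n \<Rightarrow> real. weight w \<longrightarrow> (w \<in> Ap_class p \<longleftrightarrow> Ap_Poi_norm p q w < \<infinity>)) \<and>
    (\<exists>C :: real. 0 < C \<and> (\<forall>w :: complex ^ 'n \<Rightarrow> real. weight w \<longrightarrow>
       ennreal (1 / C) * Ap_norm p w \<le> Ap_Poi_norm p q w \<and>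
       Ap_Poi_norm p q w \<le> ennreal C * ennreal_powr (Ap_norm p w) (max (p + 1) (q + 1))))"
proof -
  obtain L where L: "0 < L" "\<And>w :: complex ^ 'n \<Rightarrow> real. weight w \<Longrightarrow> Ap_norm p w \<le> ennreal L * Ap_Poi_norm p q w"
    using Ap_norm_le_Ap_Poi_norm[OF assms] by metis
  obtain C0 where C0: "0 < C0"
    "\<And>(w :: complex ^ 'n \<Rightarrow> real) A. weight w \<Longrightarrow> Ap_norm p w = ennreal A \<Longrightarrow> 0 \<le> A \<Longrightarrow>
       Ap_Poi_norm p q w \<le> ennreal (C0 * A powr max p q)"
    using Ap_Poi_norm_le_Ap_norm[OF assms] by metis
  define C where "C = max L C0"
  have C: "0 < C" "L \<le> C" "C0 \<le> C" using L by (auto simp: C_def)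
  have lower: "ennreal (1 / C) * Ap_norm p w \<le> Ap_Poi_norm p q w" if w: "weight w" for w :: "complex ^ 'n \<Rightarrow> real"
  proof -
    have "ennreal (1 / C) * Ap_norm p w \<le> ennreal (1 / C) * (ennreal L * Ap_Poi_norm p q w)"
      by (intro mult_left_mono L w) simp
    also have "\<dots> = ennreal (L / C) * Ap_Poi_norm p q w"
      using L C by (simp add: mult.assoc[symmetric] flip: ennreal_mult)
    also have "\<dots> \<le> 1 * Ap_Poi_norm p q w"
      using L C by (intro mult_right_mono) (auto simp: ennreal_le_1)
    finally show ?thesis by simp
  qed
  have upper: "Ap_Poi_norm p q w \<le> ennreal C * ennreal_powr (Ap_norm p w) (max (p + 1) (q + 1))"
    if w: "weight w" for w :: "complex ^ 'n \<Rightarrow> real"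
  proof (cases "Ap_norm p w")
    case (real A)
    \<comment> \<open>With \<open>A \<ge> 1\<close> the exponent \<open>max p q\<close> may be
      raised to \<open>max (p + 1) (q + 1)\<close>.\<close>
    have "1 \<le> A" using Ap_norm_ge_1[OF w assms] real by blast
    then have "C0 * A powr max p q \<le> C * A powr max (p + 1) (q + 1)"
      using C C0 by (intro mult_mono powr_mono) auto
    then have "ennreal (C0 * A powr max p q) \<le> ennreal C * ennreal_powr (Ap_norm p w) (max (p + 1) (q + 1))"
      using real C by (simp add: ennreal_powr_ennreal ennreal_leI flip: ennreal_mult)
    with C0(2)[OF w] real show ?thesis by (meson order_trans)
  next
    \<comment> \<open>\<open>ennreal_powr\<close> is infinite at infinity, so the right side is
      infinite.\<close>
    case top
    then show ?thesis using C by (simp add: ennreal_powr_def ennreal_mult_top)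
  qed
  have "w \<in> Ap_class p \<longleftrightarrow> Ap_Poi_norm p q w < \<infinity>" if w: "weight w" for w :: "complex ^ 'n \<Rightarrow> real"
  proof
    assume "w \<in> Ap_class p"
    then have "ennreal_powr (Ap_norm p w) (max (p + 1) (q + 1)) < \<infinity>"
      by (auto simp: Ap_class_def ennreal_powr_def less_top)
    then show "Ap_Poi_norm p q w < \<infinity>"
      using upper[OF w] by (auto simp: ennreal_mult_less_top intro: le_less_trans)
  next
    assume "Ap_Poi_norm p q w < \<infinity>"
    then have "ennreal L * Ap_Poi_norm p q w < \<infinity>" by (simp add: ennreal_mult_less_top)
    then have "Ap_norm p w < \<infinity>" using L(2)[OF w] by (rule le_less_trans[rotated])
    then show "w \<in> Ap_class p" using w by (simp add: Ap_class_def)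
  qed
  then show ?thesis using C(1) lower upper by blast
qed

end
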